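(* Let $a,b,\sigma\ge 0$, let $\rho,\theta$ be probability measures on $(0,+\infty)$, let $Q=(Q_t)_{t\in\mathbb{R}}$ be a stationary non-negative discharge process with mean $\bar Q>0$, variance $\bar V>0$ and autocorrelation $A_Q(h)=\int_0^{+\infty}e^{-rh}\,\theta(\mathrm{d}r)$ ($h\ge0$), and let $M=(M_t)_{t\in\mathbb{R}}$, $M_t=\int_0^{+\infty}m_t(\mathrm{d}R)$, be the memory process driven by $Q$ with parameters $a,b,\sigma,\rho$ (as defined in the context), in the stationary state. Then for every $t\in\mathbb{R}$, $$\mathbb{E}[M_t]=a+b\bar Q$$ and $$\mathbb{V}[M_t]=\frac12\sigma^2\,\mathbb{E}[M_t]+b^2\bar V\int_{R=0}^{R=+\infty}\int_{P=0}^{P=+\infty}\int_{r=0}^{r=+\infty}\frac{PR}{P+R}\left(\frac{1}{P+r}+\frac{1}{R+r}\right)\theta(\mathrm{d}r)\,\rho(\mathrm{d}R)\,\rho(\mathrm{d}P).$$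
   Context: All processes live on a complete probability space with a filtration; $\mathbb{E}$ and $\mathbb{V}$ denote expectation and variance. Discharge: $Q=(Q_t)_{t\in\mathbb{R}}$ is a real-valued, non-negative, stationary, continuous-time process with $\bar Q=\mathbb{E}[Q_t]>0$, $\bar V=\mathbb{V}[Q_t]>0$, and $\mathbb{E}[(Q_s-\bar Q)(Q_t-\bar Q)]=\bar V A_Q(|s-t|)$, where $A_Q(h)=\int_0^{+\infty}e^{-rh}\theta(\mathrm{d}r)$ for $h\ge0$ and $\theta$ is a probability measure on $(0,+\infty)$. Memory process: let $a,b,\sigma\ge0$ and let $\rho$ be a probability measure on $(0,+\infty)$. The process $m=(m_t(\mathrm{d}R))_{t\in\mathbb{R}}$ is a stationary process with values in the non-negative measures on $(0,+\infty)$ solving $$\mathrm{d}m_t(\mathrm{d}R)=-R\bigl(m_t(\mathrm{d}R)-(a+bQ_t)\rho(\mathrm{d}R)\bigr)\mathrm{d}t+\sigma\sqrt{R}\,B(\mathrm{d}R,\mathrm{d}t),$$ understood in the integrated form $$m_t(\mathrm{d}R)=\int_{s=-\infty}^{s=t}e^{-R(t-s)}\left\{R(a+bQ_s)\rho(\mathrm{d}R)\,\mathrm{d}s+\sigma\sqrt{R}\,B(\mathrm{d}R,\mathrm{d}s)\right\},$$ and the memory process is the total mass $M_t=\int_0^{+\infty}m_t(\mathrm{d}R)$. Here $B$ is the space-time random measure (two-sided in time) formally given by $B(\mathrm{d}R,\mathrm{d}t)=\sqrt{m_t(\mathrm{d}R)}\,\zeta(\mathrm{d}R,\mathrm{d}t)$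 with $\zeta$ a space-time Gaussian white noise independent of $Q$; formally $\mathbb{E}[B(\mathrm{d}R,\mathrm{d}t)B(\mathrm{d}R',\mathrm{d}t')]=\delta(R-R')\delta(t-t')\,\mathbb{E}\bigl[\sqrt{m_t(\mathrm{d}R)m_{t'}(\mathrm{d}R')}\bigr]\mathrm{d}t\,\mathrm{d}t'$. This means: for deterministic $f,g$ on $(0,+\infty)\times\mathbb{R}$ with $\mathbb{E}\bigl[\iint f^2\,m_s(\mathrm{d}R)\mathrm{d}s\bigr]<\infty$ and likewise for $g$, the stochastic integrals have mean zero, satisfy the isometry $$\mathbb{E}\Bigl[\iint f(R,s)B(\mathrm{d}R,\mathrm{d}s)\iint g(R,s)B(\mathrm{d}R,\mathrm{d}s)\Bigr]=\mathbb{E}\Bigl[\iint f(R,s)g(R,s)\,m_s(\mathrm{d}R)\,\mathrm{d}s\Bigr],$$ and are uncorrelated with every square-integrable random variable measurable with respect to $\sigma(Q_u:u\in\mathbb{R})$. *)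

theory Defs
  imports "HOL-Probability.Probability"
begin

definition pos_borel :: "real measure" where
  "pos_borel = restrict_space borel {0<..}"

definition prob_on_pos :: "real measure \<Rightarrow> bool" where
  "prob_on_pos \<mu> \<longleftrightarrow> prob_space \<mu> \<and> sets \<mu> = sets pos_borel"

(* State space of measure-valued processes: all non-negative measures on the measurable
   space K, with the sigma-algebra generated by the evaluations on measurable sets
   (as subprob_algebra, but without a bound on the total mass). *)
definition measure_algebra :: "'a measure \<Rightarrow> 'a measure measure" where
  "measure_algebra K =
    (SUP A \<in> sets K. vimage_algebra {\<mu>. sets \<mu> = sets K} (\<lambda>\<mu>. emeasure \<mu> A) borel)"

(* Strict stationarity of a process indexed by the real line with values in N. *)
definition stationary_process ::
  "'w measure \<Rightarrow> 'e measure \<Rightarrow> (real \<Rightarrow> 'w \<Rightarrow> 'e) \<Rightarrow> bool" where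
  "stationary_process P N X \<longleftrightarrow>
     (\<forall>t. X t \<in> measurable P N) \<and>
     (\<forall>h J. finite J \<longrightarrow>
        distr P (\<Pi>\<^sub>M t\<in>J. N) (\<lambda>w. \<lambda>t\<in>J. X (t + h) w) =
        distr P (\<Pi>\<^sub>M t\<in>J. N) (\<lambda>w. \<lambda>t\<in>J. X t w))"

(* Joint measurability in time and chance, needed for the time integrals to make sense. *)
definition measurable_process ::
  "'w measure \<Rightarrow> 'e measure \<Rightarrow> (real \<Rightarrow> 'w \<Rightarrow> 'e) \<Rightarrow> bool" where
  "measurable_process P N X \<longleftrightarrow> (\<lambda>(t, w). X t w) \<in> measurable (borel \<Otimes>\<^sub>M P) N"

definition process_sigma :: "'w measure \<Rightarrow> (real \<Rightarrow> 'w \<Rightarrow> real) \<Rightarrow> 'w measure" where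
  "process_sigma P Q = vimage_algebra (space P) (\<lambda>w u. Q u w) (\<Pi>\<^sub>M u\<in>UNIV. borel)"

definition filtered_complete_prob_space :: "'w measure \<Rightarrow> (real \<Rightarrow> 'w measure) \<Rightarrow> bool" where
  "filtered_complete_prob_space P F \<longleftrightarrow>
     prob_space P \<and> complete_measure P \<and>
     filtration (space P) F \<and> (\<forall>t. subalgebra P (F t))"

definition exp_mixture :: "real measure \<Rightarrow> real \<Rightarrow> real" where
  "exp_mixture \<theta> h = (\<integral>r. exp (- (r * h)) \<partial>\<theta>)"

definition discharge_process ::
  "'w measure \<Rightarrow> real measure \<Rightarrow> real \<Rightarrow> real \<Rightarrow> (real \<Rightarrow> 'w \<Rightarrow> real) \<Rightarrow> bool" where
  "discharge_process P \<theta> Qbar Vbar Q \<longleftrightarrow>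
     measurable_process P borel Q \<and>
     stationary_process P borel Q \<and>
     (\<forall>t. \<forall>w\<in>space P. 0 \<le> Q t w) \<and>
     (\<forall>t. integrable P (Q t) \<and> integrable P (\<lambda>w. (Q t w)\<^sup>2)) \<and>
     (\<forall>t. prob_space.expectation P (Q t) = Qbar) \<and>
     (\<forall>t. prob_space.variance P (Q t) = Vbar) \<and>
     (\<forall>s t. prob_space.expectation P (\<lambda>w. (Q s w - Qbar) * (Q t w - Qbar)) =
            Vbar * exp_mixture \<theta> \<bar>s - t\<bar>)"

(* Deterministic integrands f (R, s) with finite expected double integral of
   f^2 against m_s(dR) ds. *)
definition admissible_integrand ::
  "'w measure \<Rightarrow> (real \<Rightarrow> 'w \<Rightarrow> real measure) \<Rightarrow> (real \<times> real \<Rightarrow> real) \<Rightarrow> bool" where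
  "admissible_integrand P m f \<longleftrightarrow>
     f \<in> borel_measurable (pos_borel \<Otimes>\<^sub>M borel) \<and>
     (\<integral>\<^sup>+w. (\<integral>\<^sup>+s. (\<integral>\<^sup>+R. ennreal ((f (R, s))\<^sup>2) \<partial>m s w) \<partial>lborel) \<partial>P) < \<infinity>"

(* The space-time random measure is represented by its stochastic integral: B f is the
   random variable given by integrating f against B(dR, ds), so the value of the measure on a
   set C is B (indicator C).  The isometry makes B almost surely linear in f and
   L2-continuous, hence countably additive in L2 on sets, so these properties need not be
   postulated.  Outside the admissible integrands the value of B is unspecified. *)
definition memory_noise ::
  "'w measure \<Rightarrow> (real \<Rightarrow> 'w \<Rightarrow> real) \<Rightarrow> (real \<Rightarrow> 'w \<Rightarrow> real measure) \<Rightarrow>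
   ((real \<times> real \<Rightarrow> real) \<Rightarrow> 'w \<Rightarrow> real) \<Rightarrow> bool" where
  "memory_noise P Q m B \<longleftrightarrow>
     (\<forall>f. admissible_integrand P m f \<longrightarrow>
        B f \<in> borel_measurable P \<and>
        integrable P (\<lambda>w. (B f w)\<^sup>2) \<and>
        prob_space.expectation P (B f) = 0) \<and>
     (\<forall>f g. admissible_integrand P m f \<longrightarrow> admissible_integrand P m g \<longrightarrow>
        prob_space.expectation P (\<lambda>w. B f w * B g w) =
        prob_space.expectation P
          (\<lambda>w. \<integral>s. (\<integral>R. f (R, s) * g (R, s) \<partial>m s w) \<partial>lborel)) \<and>
     (\<forall>f X. admissible_integrand P m f \<longrightarrow>
        X \<in> borel_measurable (process_sigma P Q) \<longrightarrow> integrable P (\<lambda>w. (X w)\<^sup>2) \<longrightarrow>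
        prob_space.expectation P (\<lambda>w. X w * B f w) =
        prob_space.expectation P X * prob_space.expectation P (B f))"

(* Integrand of the noise term for the mass that m_t assigns to A. *)
definition noise_kernel :: "real \<Rightarrow> real \<Rightarrow> real set \<Rightarrow> real \<times> real \<Rightarrow> real" where
  "noise_kernel \<sigma> t A =
     (\<lambda>(R, s). indicator A R * indicator {..t} s * (exp (- (R * (t - s))) * (\<sigma> * sqrt R)))"

(* The integrated equation, evaluated on every measurable set A of reversion rates.
   Admissibility of the noise kernels says that its stochastic integral exists; finiteness of
   the mass is part of reading the equation as an identity between real numbers. *)
definition memory_measure_process ::
  "'w measure \<Rightarrow> real \<Rightarrow> real \<Rightarrow> real \<Rightarrow> real measure \<Rightarrow> (real \<Rightarrow> 'w \<Rightarrow> real) \<Rightarrow>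
   ((real \<times> real \<Rightarrow> real) \<Rightarrow> 'w \<Rightarrow> real) \<Rightarrow> (real \<Rightarrow> 'w \<Rightarrow> real measure) \<Rightarrow> bool" where
  "memory_measure_process P a b \<sigma> \<rho> Q B m \<longleftrightarrow>
     measurable_process P (measure_algebra pos_borel) m \<and>
     stationary_process P (measure_algebra pos_borel) m \<and>
     memory_noise P Q m B \<and>
     (\<forall>t. \<forall>A\<in>sets pos_borel.
        admissible_integrand P m (noise_kernel \<sigma> t A) \<and>
        (AE w in P.
           emeasure (m t w) A < \<infinity> \<and>
           measure (m t w) A =
             (LINT R:A|\<rho>. LINT s:{..t}|lborel.
                exp (- (R * (t - s))) * (R * (a + b * Q s w)))
             + B (noise_kernel \<sigma> t A) w))"

definition memory_process :: "(real \<Rightarrow> 'w \<Rightarrow> real measure) \<Rightarrow> real \<Rightarrow> 'w \<Rightarrow> real" where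
  "memory_process m t w = measure (m t w) {0<..}"

end

theory Submission
  imports Defs
begin

text \<open>
  Write $X_s = a + b Q_s$ for the level towards which the measure $m$ reverts, and let
  $\kappa_R$ be the law on $(-\infty, t]$ with density $R e^{-R(t-s)}$, the law of the time
  $t - T$ for an exponential waiting time $T$ of rate $R$.  Taking the total mass in the
  integrated equation gives $M_t = D + N$ almost surely, where
  $D = \int\!\int X_s\, \kappa_R(ds)\, \rho(dR)$ is an average of $X$ with respect to
  probability measures and $N$ is the stochastic integral of the noise kernel.

  The drift part $D$ is handled by applying one principle twice, to the family
  $(X_s)$ averaged over $\kappa_R$ and to the family of these averages averaged over $\rho$:
  the average of a family that is bounded in $L^2$ is again bounded in $L^2$, and its inner
  product with any square integrable random variable may be computed under the average
  (locale \<open>bounded_L2_family\<close>).  Hence $E[D] = a + b \bar Q$, and $E[D^2]$ is the double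
  average of the covariances $E[U_R U_P]$ of $U_R = \int X_s\, \kappa_R(ds)$.  Expanding the
  autocorrelation as a mixture of exponentials $e^{-r|s-s'|}$ leaves the elementary integral
  \<open>integral_past_law_pair\<close>, which is the kernel in the variance formula.

  The noise part $N$ has mean zero and is uncorrelated with $D$, because it is uncorrelated
  with every single $Q_s$ and the inner product passes through the averages.  This avoids
  showing that $D$ is measurable with respect to the sigma-algebra generated by $Q$, which
  does not follow from joint measurability of $Q$ alone.

  For $E[N^2]$, evaluating the equation on an arbitrary set $A$ of rates and
  taking expectations shows that $E[m_s(A)] = (a + b \bar Q) \rho(A)$, so the mean measure
  of $m_s$ is a multiple of $\rho$ (\<open>mean_measure\<close>).  The isometry then reduces $E[N^2]$ to
  $(a + b \bar Q) \int\!\int_{s \le t} \sigma^2 R e^{-2R(t-s)}\, ds\, \rho(dR)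
  = \frac12 \sigma^2 (a + b \bar Q)$.  Exchanging the integrals over time and chance requires
  $\int R e^{-2R(t-s)} m_s(dR)$ to be jointly measurable in time and chance, although $m_s$ is
  only known to be finite almost surely for each single $s$; this is
  \<open>measurable_nn_integral_exp_family\<close>.
\<close>

section \<open>Averages of bounded families in $L^2$\<close>

lemma abs_mult_le_sum_squares:
  fixes x y :: real
  shows "\<bar>x * y\<bar> \<le> x\<^sup>2 + y\<^sup>2"
proof -
  have "2 * (\<bar>x\<bar> * \<bar>y\<bar>) \<le> x\<^sup>2 + y\<^sup>2"
    using sum_squares_bound[of "\<bar>x\<bar>" "\<bar>y\<bar>"] by (simp add: mult.assoc)
  moreover have "0 \<le> \<bar>x\<bar> * \<bar>y\<bar>" by simp
  ultimately show ?thesis by (simp only: abs_mult)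
qed

lemma integrable_mult_of_square_integrable:
  fixes f g :: "'a \<Rightarrow> real"
  assumes [measurable]: "f \<in> borel_measurable M" "g \<in> borel_measurable M"
    and "integrable M (\<lambda>x. (f x)\<^sup>2)" "integrable M (\<lambda>x. (g x)\<^sup>2)"
  shows "integrable M (\<lambda>x. f x * g x)"
proof (rule Bochner_Integration.integrable_bound)
  show "integrable M (\<lambda>x. (f x)\<^sup>2 + (g x)\<^sup>2)"
    using assms by simp
  show "AE x in M. norm (f x * g x) \<le> norm ((f x)\<^sup>2 + (g x)\<^sup>2)"
    using abs_mult_le_sum_squares by simp
qed measurable

text \<open>
  Averaging over the index yields a random variable whose second moment obeys the bound \<open>C\<close>
  again, so averages may themselves be averaged.  The index space is a probability space
  because then the bound passes through Jensen's inequality unchanged.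
\<close>

locale bounded_L2_family = pair_prob_space K P
  for K :: "'x measure" and P :: "'w measure" +
  fixes Z :: "'x \<Rightarrow> 'w \<Rightarrow> real" and C :: real
  assumes Z_measurable [measurable]: "case_prod Z \<in> borel_measurable (K \<Otimes>\<^sub>M P)"
    and Z_square_integrable: "x \<in> space K \<Longrightarrow> integrable P (\<lambda>w. (Z x w)\<^sup>2)"
    and Z_square_bound: "x \<in> space K \<Longrightarrow> (\<integral>w. (Z x w)\<^sup>2 \<partial>P) \<le> C"
begin

definition average :: "'w \<Rightarrow> real" where
  "average w = (\<integral>x. Z x w \<partial>K)"

lemma average_measurable [measurable]: "average \<in> borel_measurable P"
  unfolding average_def by measurable

text \<open>
  Jensen's inequality for the square, path by path.  In extended form it also covers the paths
  along which the square is not integrable, where the average is given the value 0 by default.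
\<close>

lemma ennreal_average_square_le:
  assumes w: "w \<in> space P"
  shows "ennreal ((average w)\<^sup>2) \<le> (\<integral>\<^sup>+x. ennreal ((Z x w)\<^sup>2) \<partial>K)"
proof -
  have [measurable]: "(\<lambda>x. Z x w) \<in> borel_measurable K"
    using measurable_Pair1[OF Z_measurable w] by simp
  show ?thesis
  proof (cases "integrable K (\<lambda>x. (Z x w)\<^sup>2)")
    case True
    have Z: "integrable K (\<lambda>x. Z x w)"
      by (rule M1.square_integrable_imp_integrable[OF _ True]) measurable
    have "0 \<le> M1.variance (\<lambda>x. Z x w)"
      by (rule M1.variance_positive)
    also have "\<dots> = (\<integral>x. (Z x w)\<^sup>2 \<partial>K) - (average w)\<^sup>2"
      unfolding average_def by (rule M1.variance_eq[OF Z True])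
    finally have "ennreal ((average w)\<^sup>2) \<le> ennreal (\<integral>x. (Z x w)\<^sup>2 \<partial>K)"
      by (intro ennreal_leI) linarith
    also have "\<dots> = (\<integral>\<^sup>+x. ennreal ((Z x w)\<^sup>2) \<partial>K)"
      by (rule nn_integral_eq_integral[OF True, symmetric]) simp
    finally show ?thesis .
  next
    case False
    have "\<not> (\<integral>\<^sup>+x. ennreal ((Z x w)\<^sup>2) \<partial>K) < \<infinity>"
    proof
      assume "(\<integral>\<^sup>+x. ennreal ((Z x w)\<^sup>2) \<partial>K) < \<infinity>"
      then have "integrable K (\<lambda>x. (Z x w)\<^sup>2)"
        by (rule integrableI_nonneg[rotated 2]) simp_all
      with False show False ..
    qed
    then show ?thesis
      by (simp add: not_less top_unique)
  qed
qed

lemma nn_integral_Z_square_le: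
  assumes "x \<in> space K"
  shows "(\<integral>\<^sup>+w. ennreal ((Z x w)\<^sup>2) \<partial>P) \<le> ennreal C"
  using nn_integral_eq_integral[OF Z_square_integrable[OF assms]] Z_square_bound[OF assms]
  by (simp add: ennreal_leI)

lemma C_nonneg: "0 \<le> C"
proof -
  obtain x where "x \<in> space K"
    using M1.not_empty by auto
  have "0 \<le> (\<integral>w. (Z x w)\<^sup>2 \<partial>P)"
    by simp
  with Z_square_bound[OF \<open>x \<in> space K\<close>] show ?thesis by linarith
qed

lemma nn_integral_average_square_le: "(\<integral>\<^sup>+w. ennreal ((average w)\<^sup>2) \<partial>P) \<le> ennreal C"
proof -
  have "(\<integral>\<^sup>+w. ennreal ((average w)\<^sup>2) \<partial>P) \<le> (\<integral>\<^sup>+w. \<integral>\<^sup>+x. ennreal ((Z x w)\<^sup>2) \<partial>K \<partial>P)"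
    by (intro nn_integral_mono ennreal_average_square_le)
  also have "\<dots> = (\<integral>\<^sup>+x. \<integral>\<^sup>+w. ennreal ((Z x w)\<^sup>2) \<partial>P \<partial>K)"
    by (intro Fubini') measurable
  also have "\<dots> \<le> (\<integral>\<^sup>+x. ennreal C \<partial>K)"
    by (intro nn_integral_mono nn_integral_Z_square_le)
  also have "\<dots> = ennreal C"
    using M1.emeasure_space_1 by (simp only: nn_integral_const mult_1_right)
  finally show ?thesis .
qed

lemma average_square_integrable: "integrable P (\<lambda>w. (average w)\<^sup>2)"
proof (rule integrableI_nonneg)
  show "(\<integral>\<^sup>+w. ennreal ((average w)\<^sup>2) \<partial>P) < \<infinity>"
    using nn_integral_average_square_le by (rule order_le_less_trans) simp
qed auto

lemma average_integrable: "integrable P average"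
  by (rule M2.square_integrable_imp_integrable[OF _ average_square_integrable]) simp

lemma average_square_bound: "(\<integral>w. (average w)\<^sup>2 \<partial>P) \<le> C"
  using nn_integral_average_square_le nn_integral_eq_integral[OF average_square_integrable] C_nonneg
  by simp

lemma integrable_product_with_square_integrable:
  assumes N [measurable]: "N \<in> borel_measurable P" and N2: "integrable P (\<lambda>w. (N w)\<^sup>2)"
  shows "integrable (K \<Otimes>\<^sub>M P) (\<lambda>(x, w). Z x w * N w)"
proof (rule integrableI_bounded)
  have "(\<integral>\<^sup>+z. ennreal (norm (case z of (x, w) \<Rightarrow> Z x w * N w)) \<partial>(K \<Otimes>\<^sub>M P))
      \<le> (\<integral>\<^sup>+z. (case z of (x, w) \<Rightarrow> ennreal ((Z x w)\<^sup>2) + ennreal ((N w)\<^sup>2)) \<partial>(K \<Otimes>\<^sub>M P))"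
  proof (intro nn_integral_mono, clarify)
    fix x w
    show "ennreal (norm (Z x w * N w)) \<le> ennreal ((Z x w)\<^sup>2) + ennreal ((N w)\<^sup>2)"
      using abs_mult_le_sum_squares[of "Z x w" "N w"] by (simp flip: ennreal_plus)
  qed
  also have "\<dots> = (\<integral>\<^sup>+x. \<integral>\<^sup>+w. (ennreal ((Z x w)\<^sup>2) + ennreal ((N w)\<^sup>2)) \<partial>P \<partial>K)"
    by (subst M2.nn_integral_fst[symmetric]) auto
  also have "\<dots> \<le> (\<integral>\<^sup>+x. (ennreal C + (\<integral>\<^sup>+w. ennreal ((N w)\<^sup>2) \<partial>P)) \<partial>K)"
  proof (intro nn_integral_mono)
    fix x assume x [measurable]: "x \<in> space K"
    show "(\<integral>\<^sup>+w. (ennreal ((Z x w)\<^sup>2) + ennreal ((N w)\<^sup>2)) \<partial>P)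
        \<le> ennreal C + (\<integral>\<^sup>+w. ennreal ((N w)\<^sup>2) \<partial>P)"
      using nn_integral_Z_square_le[OF x] by (subst nn_integral_add) (auto intro: add_right_mono)
  qed
  also have "\<dots> < \<infinity>"
    using nn_integral_eq_integral[OF N2] by (simp add: M1.emeasure_space_1)
  finally show "(\<integral>\<^sup>+z. ennreal (norm (case z of (x, w) \<Rightarrow> Z x w * N w)) \<partial>(K \<Otimes>\<^sub>M P)) < \<infinity>" .
qed measurable

text \<open>
  Fubini's theorem, in the form in which it is used for means (with \<open>N\<close> constant), for second
  moments of averages (with \<open>N\<close> itself an average) and for correlations with the noise.
\<close>

lemma expectation_average_mult:
  assumes N [measurable]: "N \<in> borel_measurable P" and N2: "integrable P (\<lambda>w. (N w)\<^sup>2)"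
  shows "(\<integral>w. average w * N w \<partial>P) = (\<integral>x. (\<integral>w. Z x w * N w \<partial>P) \<partial>K)"
proof -
  have "(\<integral>w. average w * N w \<partial>P) = (\<integral>w. (\<integral>x. Z x w * N w \<partial>K) \<partial>P)"
    by (simp add: average_def)
  also have "\<dots> = (\<integral>x. (\<integral>w. Z x w * N w \<partial>P) \<partial>K)"
    by (rule Fubini_integral) (rule integrable_product_with_square_integrable[OF N N2])
  finally show ?thesis .
qed

end

section \<open>Exponentially weighted pasts\<close>

text \<open>
  The exponential law of rate \<open>R\<close>, reflected so as to weigh the times before \<open>t\<close>.
\<close>

definition past_law :: "real \<Rightarrow> real \<Rightarrow> real measure" where
  "past_law t R = density lborel (\<lambda>s. ennreal (exponential_density R (t - s)))"

lemma sets_past_law [simp, measurable_cong]: "sets (past_law t R) = sets borel"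
  by (simp add: past_law_def)

lemma space_past_law [simp]: "space (past_law t R) = UNIV"
  by (simp add: past_law_def)

lemma nn_integral_reflect:
  fixes t :: real
  assumes [measurable]: "f \<in> borel_measurable borel"
  shows "(\<integral>\<^sup>+s. f (t - s) \<partial>lborel) = (\<integral>\<^sup>+u. f u \<partial>lborel)"
  using nn_integral_real_affine[of f "-1" t] by simp

lemma prob_space_past_law:
  assumes "0 < R"
  shows "prob_space (past_law t R)"
proof (rule prob_spaceI)
  interpret E: prob_space "density lborel (exponential_density R)"
    using assms by (rule prob_space_exponential_density)
  have "emeasure (past_law t R) (space (past_law t R)) =
      (\<integral>\<^sup>+s. ennreal (exponential_density R (t - s)) \<partial>lborel)"
    by (simp add: past_law_def emeasure_density)
  also have "\<dots> = (\<integral>\<^sup>+u. ennreal (exponential_density R u) \<partial>lborel)"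
    by (intro nn_integral_reflect) measurable
  also have "\<dots> = 1"
    using E.emeasure_space_1 by (simp add: emeasure_density)
  finally show "emeasure (past_law t R) (space (past_law t R)) = 1" .
qed

lemma exponential_density_diff:
  "exponential_density R (t - s) = indicator {..t} s * (R * exp (- (R * (t - s))))"
  by (simp add: exponential_density_def indicator_def algebra_simps)

lemma nn_integral_exp_below:
  assumes "0 < c"
  shows "(\<integral>\<^sup>+s. ennreal (exp (- (c * (t - s)))) * indicator {..t} s \<partial>lborel) = ennreal (1 / c)"
proof -
  interpret E: prob_space "past_law t c"
    using assms by (rule prob_space_past_law)
  have "(\<integral>\<^sup>+s. ennreal (exp (- (c * (t - s)))) * indicator {..t} s \<partial>lborel) =
      (\<integral>\<^sup>+s. ennreal (1 / c) * ennreal (exponential_density c (t - s)) \<partial>lborel)"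
    using assms
    by (intro nn_integral_cong)
      (auto simp: exponential_density_diff indicator_def simp flip: ennreal_mult')
  also have "\<dots> = ennreal (1 / c) * emeasure (past_law t c) (space (past_law t c))"
    by (simp add: nn_integral_cmult past_law_def emeasure_density)
  finally show ?thesis by (simp only: E.emeasure_space_1 mult_1_right)
qed

lemma nn_integral_past_law_tail:
  assumes p: "0 < p" and r: "0 < r" and x: "x \<le> t" and S: "S = {..x} \<or> S = {..<x}"
  shows "(\<integral>\<^sup>+s. ennreal (exp (- (r * (x - s)))) * indicator S s \<partial>past_law t p)
    = ennreal (p / (p + r) * exp (- (p * (t - x))))"
proof -
  have [measurable]: "S \<in> sets borel"
    using S by auto
  have "(\<integral>\<^sup>+s. ennreal (exp (- (r * (x - s)))) * indicator S s \<partial>past_law t p)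
      = (\<integral>\<^sup>+s. ennreal (exponential_density p (t - s)) *
          (ennreal (exp (- (r * (x - s)))) * indicator S s) \<partial>lborel)"
    unfolding past_law_def by (subst nn_integral_density) auto
  also have "\<dots> = (\<integral>\<^sup>+s. ennreal (p * exp (- (p * (t - x)))) *
          (ennreal (exp (- ((p + r) * (x - s)))) * indicator {..x} s) \<partial>lborel)"
  proof (rule nn_integral_cong_AE)
    show "AE s in lborel. ennreal (exponential_density p (t - s)) *
          (ennreal (exp (- (r * (x - s)))) * indicator S s) =
        ennreal (p * exp (- (p * (t - x)))) *
          (ennreal (exp (- ((p + r) * (x - s)))) * indicator {..x} s)"
      using AE_lborel_singleton[of x]
    proof eventually_elim
      case (elim s)
      then have ind: "indicator S s = (indicator {..x} s :: ennreal)"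
        using S by (auto simp: indicator_def)
      show ?case
      proof (cases "s \<le> x")
        case True
        have "exp (- (p * (t - s))) * exp (- (r * (x - s)))
            = exp (- (p * (t - x))) * exp (- ((p + r) * (x - s)))"
          by (simp add: algebra_simps flip: exp_add)
        with True x p show ?thesis
          unfolding ind by (simp add: exponential_density_diff mult.assoc flip: ennreal_mult')
      qed (simp add: ind)
    qed
  qed
  also have "\<dots> = ennreal (p * exp (- (p * (t - x)))) * ennreal (1 / (p + r))"
    using p r by (simp add: nn_integral_cmult nn_integral_exp_below)
  finally show ?thesis
    using p r by (simp add: mult.commute flip: ennreal_mult')
qed

text \<open>
  The contribution of the pairs in which the time with rate \<open>p\<close> comes first: conditioning on
  the later time \<open>x\<close>, the inner integral contributes $\frac{p}{p+r} e^{-p(t-x)}$, which is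
  integrated against $R e^{-R(t-x)}$.  Both the weak and the strict order are needed, because the
  plane is split along the diagonal.
\<close>

lemma nn_integral_past_law_ordered_pair:
  assumes p: "0 < p" and r: "0 < r" and R: "0 < R"
    and S: "S = (\<lambda>x. {..x}) \<or> S = (\<lambda>x. {..<x})"
  shows "(\<integral>\<^sup>+x. (\<integral>\<^sup>+s. ennreal (exp (- (r * (x - s)))) * indicator (S x) s \<partial>past_law t p) \<partial>past_law t R)
    = ennreal (p * R / ((p + R) * (p + r)))"
proof -
  have tail: "ennreal (exponential_density R (t - x)) *
        (\<integral>\<^sup>+s. ennreal (exp (- (r * (x - s)))) * indicator (S x) s \<partial>past_law t p)
      = ennreal (R * (p / (p + r))) *
          (ennreal (exp (- ((p + R) * (t - x)))) * indicator {..t} x)" for x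
  proof (cases "x \<le> t")
    case True
    have "exp (- (R * (t - x))) * exp (- (p * (t - x))) = exp (- ((p + R) * (t - x)))"
      by (simp add: algebra_simps flip: exp_add)
    with True p r R S show ?thesis
      by (subst nn_integral_past_law_tail)
        (auto simp: exponential_density_diff mult.assoc mult.left_commute[of _ p] simp flip: ennreal_mult')
  qed (auto simp: exponential_density_diff)
  have "(\<integral>\<^sup>+x. (\<integral>\<^sup>+s. ennreal (exp (- (r * (x - s)))) * indicator (S x) s \<partial>past_law t p) \<partial>past_law t R)
      = (\<integral>\<^sup>+x. ennreal (exponential_density R (t - x)) *
          (\<integral>\<^sup>+s. ennreal (exp (- (r * (x - s)))) * indicator (S x) s \<partial>past_law t p) \<partial>lborel)"
  proof -
    interpret p: prob_space "past_law t p"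
      using p by (rule prob_space_past_law)
    have "(\<lambda>x. \<integral>\<^sup>+s. ennreal (exp (- (r * (x - s)))) * indicator (S x) s \<partial>past_law t p)
        \<in> borel_measurable lborel"
      using S by (elim disjE) (simp_all add: indicator_def)
    then show ?thesis
      unfolding past_law_def[of t R] by (subst nn_integral_density) auto
  qed
  also have "\<dots> = ennreal (R * (p / (p + r))) * ennreal (1 / (p + R))"
    using p R by (simp only: tail) (simp add: nn_integral_cmult nn_integral_exp_below)
  finally show ?thesis
    using p R r by (simp add: ac_simps flip: ennreal_mult')
qed

text \<open>
  Splitting according to which of the two times comes first produces the two summands of the
  kernel.
\<close>

lemma nn_integral_past_law_pair:
  assumes p: "0 < p" and r: "0 < r" and R: "0 < R"
  shows "(\<integral>\<^sup>+x. (\<integral>\<^sup>+s. ennreal (exp (- (r * \<bar>x - s\<bar>))) \<partial>past_law t p) \<partial>past_law t R)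
    = ennreal (p * R / (p + R) * (1 / (p + r) + 1 / (R + r)))"
proof -
  interpret p: prob_space "past_law t p"
    using p by (rule prob_space_past_law)
  interpret R: prob_space "past_law t R"
    using R by (rule prob_space_past_law)
  interpret pR: pair_prob_space "past_law t p" "past_law t R" ..
  have [measurable]: "(\<lambda>z. indicator {..fst z} (snd z)) \<in> borel_measurable (M1 \<Otimes>\<^sub>M M2)"
    "(\<lambda>z. indicator {..<snd z} (fst z)) \<in> borel_measurable (M1 \<Otimes>\<^sub>M M2)"
    if [measurable_cong]: "sets M1 = sets borel" "sets M2 = sets borel"
    for M1 M2 :: "real measure"
    by (simp_all add: indicator_def)
  have "(\<integral>\<^sup>+x. (\<integral>\<^sup>+s. ennreal (exp (- (r * \<bar>x - s\<bar>))) \<partial>past_law t p) \<partial>past_law t R)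
      = (\<integral>\<^sup>+x. (\<integral>\<^sup>+s. ennreal (exp (- (r * (x - s)))) * indicator {..x} s +
          ennreal (exp (- (r * (s - x)))) * indicator {..<s} x \<partial>past_law t p) \<partial>past_law t R)"
    by (intro nn_integral_cong) (auto simp: indicator_def)
  also have "\<dots> = (\<integral>\<^sup>+x. (\<integral>\<^sup>+s. ennreal (exp (- (r * (x - s)))) * indicator {..x} s \<partial>past_law t p) \<partial>past_law t R)
      + (\<integral>\<^sup>+x. (\<integral>\<^sup>+s. ennreal (exp (- (r * (s - x)))) * indicator {..<s} x \<partial>past_law t p) \<partial>past_law t R)"
  proof -
    have "(\<integral>\<^sup>+s. ennreal (exp (- (r * (x - s)))) * indicator {..x} s +
          ennreal (exp (- (r * (s - x)))) * indicator {..<s} x \<partial>past_law t p)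
        = (\<integral>\<^sup>+s. ennreal (exp (- (r * (x - s)))) * indicator {..x} s \<partial>past_law t p)
        + (\<integral>\<^sup>+s. ennreal (exp (- (r * (s - x)))) * indicator {..<s} x \<partial>past_law t p)" for x
      by (intro nn_integral_add) (simp_all add: indicator_def)
    then show ?thesis
      by (simp only:) (intro nn_integral_add; simp add: indicator_def)
  qed
  also have "(\<integral>\<^sup>+x. (\<integral>\<^sup>+s. ennreal (exp (- (r * (s - x)))) * indicator {..<s} x \<partial>past_law t p) \<partial>past_law t R)
      = (\<integral>\<^sup>+s. (\<integral>\<^sup>+x. ennreal (exp (- (r * (s - x)))) * indicator {..<s} x \<partial>past_law t R) \<partial>past_law t p)"
    by (rule pR.Fubini') (simp add: split_beta' indicator_def)
  also have "\<dots> = ennreal (R * p / ((R + p) * (R + r)))"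
    using p r R by (intro nn_integral_past_law_ordered_pair) auto
  also have "(\<integral>\<^sup>+x. (\<integral>\<^sup>+s. ennreal (exp (- (r * (x - s)))) * indicator {..x} s \<partial>past_law t p) \<partial>past_law t R)
      = ennreal (p * R / ((p + R) * (p + r)))"
    using p r R by (intro nn_integral_past_law_ordered_pair) auto
  finally show ?thesis
    using p r R by (simp add: distrib_left ac_simps flip: ennreal_plus)
qed

lemma integral_past_law_pair:
  assumes p: "0 < p" and r: "0 < r" and R: "0 < R"
  shows "(\<integral>x. (\<integral>s. exp (- (r * \<bar>x - s\<bar>)) \<partial>past_law t p) \<partial>past_law t R)
    = p * R / (p + R) * (1 / (p + r) + 1 / (R + r))"
proof -
  interpret p: prob_space "past_law t p"
    using p by (rule prob_space_past_law)
  interpret R: prob_space "past_law t R"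
    using R by (rule prob_space_past_law)
  have inner: "ennreal (\<integral>s. exp (- (r * \<bar>x - s\<bar>)) \<partial>past_law t p)
      = (\<integral>\<^sup>+s. ennreal (exp (- (r * \<bar>x - s\<bar>))) \<partial>past_law t p)" for x
    using r by (intro nn_integral_eq_integral[symmetric] p.integrable_const_bound[where B=1]) auto
  have "(\<integral>x. (\<integral>s. exp (- (r * \<bar>x - s\<bar>)) \<partial>past_law t p) \<partial>past_law t R)
      = enn2real (\<integral>\<^sup>+x. ennreal (\<integral>s. exp (- (r * \<bar>x - s\<bar>)) \<partial>past_law t p) \<partial>past_law t R)"
    by (rule integral_eq_nn_integral) auto
  then show ?thesis
    using p r R by (simp add: inner nn_integral_past_law_pair)
qed

lemma space_prob_on_pos: "prob_on_pos \<theta> \<Longrightarrow> space \<theta> = {0<..}"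
  by (auto simp: prob_on_pos_def pos_borel_def space_restrict_space dest!: sets_eq_imp_space_eq)

lemma borel_measurable_pos_borel: "f \<in> borel_measurable borel \<Longrightarrow> f \<in> borel_measurable pos_borel"
  unfolding pos_borel_def by (rule measurable_restrict_space1)

text \<open>
  These two rules let the measurability prover treat the rates, which are points of the
  restricted space, as ordinary real numbers.
\<close>

lemma snd_pos_measurable [measurable]: "snd \<in> borel_measurable (M \<Otimes>\<^sub>M pos_borel)"
  using measurable_compose[OF measurable_snd borel_measurable_pos_borel[OF measurable_ident]] by simp

lemma fst_pos_measurable [measurable]: "fst \<in> borel_measurable (pos_borel \<Otimes>\<^sub>M M)"
  using measurable_compose[OF measurable_fst borel_measurable_pos_borel[OF measurable_ident]] by simp

lemma integral_past_law_pair_exp_mixture: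
  assumes \<theta>: "prob_on_pos \<theta>" and p: "0 < p" and R: "0 < R"
  shows "(\<integral>x. (\<integral>s. exp_mixture \<theta> \<bar>x - s\<bar> \<partial>past_law t p) \<partial>past_law t R)
    = (\<integral>r. p * R / (p + R) * (1 / (p + r) + 1 / (R + r)) \<partial>\<theta>)"
proof -
  interpret \<theta>: prob_space \<theta>
    using \<theta> by (simp add: prob_on_pos_def)
  interpret p: prob_space "past_law t p"
    using p by (rule prob_space_past_law)
  interpret R: prob_space "past_law t R"
    using R by (rule prob_space_past_law)
  interpret p\<theta>: pair_prob_space \<theta> "past_law t p" ..
  interpret R\<theta>: pair_prob_space \<theta> "past_law t R" ..
  have [measurable_cong]: "sets \<theta> = sets pos_borel"
    using \<theta> by (simp add: prob_on_pos_def)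
  have pos: "0 < r" if "r \<in> space \<theta>" for r
    using that space_prob_on_pos[OF \<theta>] by auto
  have "(\<integral>s. exp_mixture \<theta> \<bar>x - s\<bar> \<partial>past_law t p)
      = (\<integral>r. (\<integral>s. exp (- (r * \<bar>x - s\<bar>)) \<partial>past_law t p) \<partial>\<theta>)" for x
    unfolding exp_mixture_def
  proof (rule p\<theta>.Fubini_integral, rule p\<theta>.integrable_const_bound[where B=1])
    show "AE z in \<theta> \<Otimes>\<^sub>M past_law t p. norm (case z of (r, s) \<Rightarrow> exp (- (r * \<bar>x - s\<bar>))) \<le> 1"
      by (intro AE_I2) (auto simp: space_pair_measure less_imp_le[OF pos])
  qed (simp add: split_beta')
  then have "(\<integral>x. (\<integral>s. exp_mixture \<theta> \<bar>x - s\<bar> \<partial>past_law t p) \<partial>past_law t R)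
      = (\<integral>x. (\<integral>r. (\<integral>s. exp (- (r * \<bar>x - s\<bar>)) \<partial>past_law t p) \<partial>\<theta>) \<partial>past_law t R)"
    by simp
  also have "\<dots> = (\<integral>r. (\<integral>x. (\<integral>s. exp (- (r * \<bar>x - s\<bar>)) \<partial>past_law t p) \<partial>past_law t R) \<partial>\<theta>)"
  proof (rule R\<theta>.Fubini_integral, rule R\<theta>.integrable_const_bound[where B=1])
    have "(\<integral>s. exp (- (r * \<bar>x - s\<bar>)) \<partial>past_law t p) \<le> 1" if "r \<in> space \<theta>" for r x
      using pos[OF that]
      by (intro p.integral_le_const p.integrable_const_bound[where B=1]) auto
    then show "AE z in \<theta> \<Otimes>\<^sub>M past_law t R.
        norm (case z of (r, x) \<Rightarrow> \<integral>s. exp (- (r * \<bar>x - s\<bar>)) \<partial>past_law t p) \<le> 1"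
      by (intro AE_I2) (auto simp: space_pair_measure)
  qed (simp add: split_beta')
  also have "\<dots> = (\<integral>r. p * R / (p + R) * (1 / (p + r) + 1 / (R + r)) \<partial>\<theta>)"
    by (intro Bochner_Integration.integral_cong integral_past_law_pair pos p R) auto
  finally show ?thesis .
qed

section \<open>Random measures\<close>

lemma space_measure_algebra: "space (measure_algebra K) = {\<mu>. sets \<mu> = sets K}"
  by (auto simp: measure_algebra_def space_Sup_eq_UN)

lemma measurable_emeasure_measure_algebra:
  "A \<in> sets K \<Longrightarrow> (\<lambda>\<mu>. emeasure \<mu> A) \<in> borel_measurable (measure_algebra K)"
  by (auto intro!: measurable_Sup1 measurable_vimage_algebra1 simp: measure_algebra_def)

lemma measurable_nn_integral_measure_algebra:
  assumes "f \<in> borel_measurable K"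
  shows "(\<lambda>\<mu>. \<integral>\<^sup>+x. f x \<partial>\<mu>) \<in> borel_measurable (measure_algebra K)" (is "_ \<in> ?B")
  using assms
proof induct
  case (cong f g)
  then have "(\<lambda>\<mu>. \<integral>\<^sup>+x. f x \<partial>\<mu>) \<in> ?B \<longleftrightarrow> (\<lambda>\<mu>. \<integral>\<^sup>+x. g x \<partial>\<mu>) \<in> ?B"
    by (intro measurable_cong nn_integral_cong cong)
      (auto simp: space_measure_algebra dest!: sets_eq_imp_space_eq)
  with cong show ?case by simp
next
  case (set A)
  then have "(\<lambda>\<mu>. \<integral>\<^sup>+x. indicator A x \<partial>\<mu>) \<in> ?B \<longleftrightarrow> (\<lambda>\<mu>. emeasure \<mu> A) \<in> ?B"
    by (intro measurable_cong nn_integral_indicator) (simp add: space_measure_algebra)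
  with set show ?case
    by (simp add: measurable_emeasure_measure_algebra)
next
  case (mult f c)
  then have "(\<lambda>\<mu>. \<integral>\<^sup>+x. c * f x \<partial>\<mu>) \<in> ?B \<longleftrightarrow> (\<lambda>\<mu>. c * (\<integral>\<^sup>+x. f x \<partial>\<mu>)) \<in> ?B"
    by (intro measurable_cong nn_integral_cmult) (simp add: space_measure_algebra cong: measurable_cong_sets)
  with mult show ?case by simp
next
  case (add f g)
  then have "(\<lambda>\<mu>. \<integral>\<^sup>+x. f x + g x \<partial>\<mu>) \<in> ?B
      \<longleftrightarrow> (\<lambda>\<mu>. (\<integral>\<^sup>+x. f x \<partial>\<mu>) + (\<integral>\<^sup>+x. g x \<partial>\<mu>)) \<in> ?B"
    by (intro measurable_cong nn_integral_add) (simp_all add: space_measure_algebra cong: measurable_cong_sets)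
  with add show ?case by (simp add: ac_simps)
next
  case (seq F)
  then have "(\<lambda>\<mu>. \<integral>\<^sup>+x. (SUP i. F i) x \<partial>\<mu>) \<in> ?B \<longleftrightarrow> (\<lambda>\<mu>. SUP i. (\<integral>\<^sup>+x. F i x \<partial>\<mu>)) \<in> ?B"
    unfolding SUP_apply
    by (intro measurable_cong nn_integral_monotone_convergence_SUP)
      (simp_all add: space_measure_algebra cong: measurable_cong_sets)
  with seq show ?case by (simp add: ac_simps)
qed

text \<open>
  A random measure is integrated in the mean against its mean measure: the claim for indicator
  functions is the hypothesis, and it extends by linearity and monotone limits.
\<close>

lemma nn_integral_mean_measure:
  assumes X: "X \<in> measurable P (measure_algebra K)" and [simp]: "sets \<rho> = sets K"
    and mean: "\<And>A. A \<in> sets K \<Longrightarrow> (\<integral>\<^sup>+w. emeasure (X w) A \<partial>P) = c * emeasure \<rho> A"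
    and f: "f \<in> borel_measurable K"
  shows "(\<integral>\<^sup>+w. (\<integral>\<^sup>+x. f x \<partial>X w) \<partial>P) = c * (\<integral>\<^sup>+x. f x \<partial>\<rho>)"
  using f
proof induct
  have sets_X: "sets (X w) = sets K" if "w \<in> space P" for w
    using measurable_space[OF X that] by (simp add: space_measure_algebra)
  have XD: "g \<in> borel_measurable (X w) \<longleftrightarrow> g \<in> borel_measurable K" if "w \<in> space P"
    for w and g :: "_ \<Rightarrow> ennreal"
    using sets_X[OF that] by (simp cong: measurable_cong_sets)
  have \<rho>D: "g \<in> borel_measurable \<rho> \<longleftrightarrow> g \<in> borel_measurable K" for g :: "_ \<Rightarrow> ennreal"
    by (simp cong: measurable_cong_sets)
  have XM: "(\<lambda>w. \<integral>\<^sup>+x. g x \<partial>X w) \<in> borel_measurable P" if "g \<in> borel_measurable K" for g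
    using measurable_compose[OF X measurable_nn_integral_measure_algebra[OF that]] .
  {
    case (cong f g)
    have "(\<integral>\<^sup>+w. (\<integral>\<^sup>+x. f x \<partial>X w) \<partial>P) = (\<integral>\<^sup>+w. (\<integral>\<^sup>+x. g x \<partial>X w) \<partial>P)"
      using cong sets_X by (intro nn_integral_cong) (auto dest!: sets_eq_imp_space_eq)
    moreover have "(\<integral>\<^sup>+x. f x \<partial>\<rho>) = (\<integral>\<^sup>+x. g x \<partial>\<rho>)"
      using cong sets_eq_imp_space_eq[of \<rho> K] by (intro nn_integral_cong) auto
    ultimately show ?case
      using cong by simp
  next
    case (set A)
    have "(\<integral>\<^sup>+w. (\<integral>\<^sup>+x. indicator A x \<partial>X w) \<partial>P) = (\<integral>\<^sup>+w. emeasure (X w) A \<partial>P)"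
      using set by (intro nn_integral_cong) (simp add: sets_X)
    with set mean show ?case by simp
  next
    case (mult f u)
    have "(\<integral>\<^sup>+w. (\<integral>\<^sup>+x. u * f x \<partial>X w) \<partial>P) = (\<integral>\<^sup>+w. u * (\<integral>\<^sup>+x. f x \<partial>X w) \<partial>P)"
      using mult by (intro nn_integral_cong nn_integral_cmult) (simp add: XD)
    with mult show ?case
      by (simp add: nn_integral_cmult XM \<rho>D mult.left_commute)
  next
    case (add f g)
    have "(\<integral>\<^sup>+w. (\<integral>\<^sup>+x. f x + g x \<partial>X w) \<partial>P)
        = (\<integral>\<^sup>+w. (\<integral>\<^sup>+x. f x \<partial>X w) + (\<integral>\<^sup>+x. g x \<partial>X w) \<partial>P)"
      using add by (intro nn_integral_cong nn_integral_add) (simp_all add: XD)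
    with add show ?case
      by (simp add: nn_integral_add XM \<rho>D distrib_left add.commute)
  next
    case (seq F)
    have "(\<integral>\<^sup>+w. (\<integral>\<^sup>+x. (SUP i. F i) x \<partial>X w) \<partial>P) = (\<integral>\<^sup>+w. (SUP i. (\<integral>\<^sup>+x. F i x \<partial>X w)) \<partial>P)"
      unfolding SUP_apply using seq
      by (intro nn_integral_cong nn_integral_monotone_convergence_SUP) (simp_all add: XD)
    also have "\<dots> = (SUP i. (\<integral>\<^sup>+w. (\<integral>\<^sup>+x. F i x \<partial>X w) \<partial>P))"
      using seq
      by (intro nn_integral_monotone_convergence_SUP XM)
        (auto simp: incseq_def le_fun_def intro!: nn_integral_mono)
    also have "\<dots> = c * (SUP i. (\<integral>\<^sup>+x. F i x \<partial>\<rho>))"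
      using seq by (simp add: SUP_mult_left_ennreal)
    also have "(SUP i. (\<integral>\<^sup>+x. F i x \<partial>\<rho>)) = (\<integral>\<^sup>+x. (SUP i. F i) x \<partial>\<rho>)"
      unfolding SUP_apply using seq
      by (intro nn_integral_monotone_convergence_SUP[symmetric]) (simp_all add: \<rho>D)
    finally show ?case .
  }
qed

text \<open>
  Joint measurability of an integral with respect to a random measure is usually obtained by a
  Dynkin argument, which needs finiteness of the measures; here they are arbitrary.  The
  exponential kernel is instead expanded: for $s \ge -n$,
  $$e^{-2R(t-s)} = e^{-2R(t+n)} \sum_k \frac{(2R)^k (s+n)^k}{k!},$$
  a series of non-negative products of a function of $R$ and a function of $s$, whose integrals are
  measurable term by term.
\<close>

lemma measurable_nn_integral_exp_family:
  assumes X: "X \<in> measurable M (measure_algebra pos_borel)"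
    and s [measurable]: "s \<in> borel_measurable M"
    and g: "g \<in> borel_measurable pos_borel"
  shows "(\<lambda>z. indicator {..t} (s z) * (\<integral>\<^sup>+R. g R * ennreal (exp (- (2 * R * (t - s z)))) \<partial>X z))
    \<in> borel_measurable M"
proof -
  have sets_X: "sets (X z) = sets pos_borel" if "z \<in> space M" for z
    using measurable_space[OF X that] by (simp add: space_measure_algebra)
  have id [measurable]: "(\<lambda>R. R) \<in> borel_measurable pos_borel"
    by (intro borel_measurable_pos_borel) simp
  note g [measurable]
  define h where "h n k R = g R * ennreal (exp (- (2 * R * (t + real n))) * (2 * R) ^ k)" for n k :: nat and R
  have h [measurable]: "h n k \<in> borel_measurable pos_borel" for n k
    unfolding h_def by measurable
  have hX [measurable]: "(\<lambda>z. \<integral>\<^sup>+R. h n k R \<partial>X z) \<in> borel_measurable M" for n k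
    using measurable_compose[OF X measurable_nn_integral_measure_algebra[OF h]] .
  let ?H = "\<lambda>z. \<integral>\<^sup>+R. g R * ennreal (exp (- (2 * R * (t - s z)))) \<partial>X z"
  have expand: "indicator {- real n..t} (s z) * ?H z
      = indicator {- real n..t} (s z) * (\<Sum>k. ennreal ((s z + real n) ^ k / fact k) * (\<integral>\<^sup>+R. h n k R \<partial>X z))"
    if z: "z \<in> space M" for n z
  proof (cases "s z \<in> {- real n..t}")
    case True
    have "g R * ennreal (exp (- (2 * R * (t - s z))))
        = (\<Sum>k. ennreal ((s z + real n) ^ k / fact k) * h n k R)" if "R \<in> space (X z)" for R
    proof -
      have R: "0 < R"
        using that sets_eq_imp_space_eq[OF sets_X[OF z]]
        by (auto simp: pos_borel_def space_restrict_space)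
      have "(\<lambda>k. exp (- (2 * R * (t + real n))) * ((2 * R * (s z + real n)) ^ k /\<^sub>R fact k))
          sums (exp (- (2 * R * (t + real n))) * exp (2 * R * (s z + real n)))"
        by (intro sums_mult exp_converges)
      moreover have "exp (- (2 * R * (t + real n))) * exp (2 * R * (s z + real n))
          = exp (- (2 * R * (t - s z)))"
        by (simp add: algebra_simps flip: exp_add)
      ultimately have "(\<Sum>k. ennreal (exp (- (2 * R * (t + real n))) * ((2 * R * (s z + real n)) ^ k
          /\<^sub>R fact k)))
          = ennreal (exp (- (2 * R * (t - s z))))"
        using R True by (intro suminf_ennreal_eq) auto
      then have "g R * ennreal (exp (- (2 * R * (t - s z))))
          = (\<Sum>k. g R * ennreal (exp (- (2 * R * (t + real n))) * ((2 * R * (s z + real n)) ^ k /\<^sub>R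
              fact k)))"
        by simp
      also have "\<dots> = (\<Sum>k. ennreal ((s z + real n) ^ k / fact k) * h n k R)"
      proof (intro suminf_cong)
        fix k
        have "exp (- (2 * R * (t + real n))) * ((2 * R * (s z + real n)) ^ k /\<^sub>R fact k)
            = (s z + real n) ^ k / fact k * (exp (- (2 * R * (t + real n))) * (2 * R) ^ k)"
          by (simp add: power_mult_distrib divide_inverse)
        then show "g R * ennreal (exp (- (2 * R * (t + real n))) * ((2 * R * (s z + real n)) ^ k /\<^sub>R fact k))
            = ennreal ((s z + real n) ^ k / fact k) * h n k R"
          using R True by (simp only: h_def) (subst ennreal_mult, auto simp: mult.left_commute)
      qed
      finally show ?thesis .
    qed
    then have "?H z = (\<integral>\<^sup>+R. (\<Sum>k. ennreal ((s z + real n) ^ k / fact k) * h n k R) \<partial>X z)"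
      by (intro nn_integral_cong)
    also have "\<dots> = (\<Sum>k. (\<integral>\<^sup>+R. ennreal ((s z + real n) ^ k / fact k) * h n k R \<partial>X z))"
      using h sets_X[OF z] by (intro nn_integral_suminf) (simp cong: measurable_cong_sets)
    also have "\<dots> = (\<Sum>k. ennreal ((s z + real n) ^ k / fact k) * (\<integral>\<^sup>+R. h n k R \<partial>X z))"
      using h sets_X[OF z] by (intro suminf_cong nn_integral_cmult) (simp cong: measurable_cong_sets)
    finally show ?thesis by simp
  qed simp
  have "(\<lambda>z. indicator {- real n..t} (s z) * ?H z) \<in> borel_measurable M" for n
    by (subst measurable_cong[OF expand]) (assumption, measurable)
  then have "(\<lambda>z. SUP n. indicator {- real n..t} (s z) * ?H z) \<in> borel_measurable M"
    by simp
  moreover have "(SUP n. indicator {- real n..t} (s z) * ?H z) = indicator {..t} (s z) * ?H z" for z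
  proof (rule antisym)
    show "(SUP n. indicator {- real n..t} (s z) * ?H z) \<le> indicator {..t} (s z) * ?H z"
      by (intro SUP_least mult_right_mono) (auto simp: indicator_def)
    obtain n where "- s z \<le> real n"
      using real_arch_simple by blast
    then have "indicator {..t} (s z) * ?H z = indicator {- real n..t} (s z) * ?H z"
      by (auto simp: indicator_def)
    then show "indicator {..t} (s z) * ?H z \<le> (SUP n. indicator {- real n..t} (s z) * ?H z)"
      by (auto intro: SUP_upper2[of n])
  qed
  ultimately show ?thesis by simp
qed

section \<open>The reversion level and its averages\<close>

locale discharge_driven_memory = prob_space P
  for P :: "'w measure" +
  fixes Q :: "real \<Rightarrow> 'w \<Rightarrow> real"
    and m :: "real \<Rightarrow> 'w \<Rightarrow> real measure"
    and B :: "(real \<times> real \<Rightarrow> real) \<Rightarrow> 'w \<Rightarrow> real"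
    and \<rho> \<theta> :: "real measure"
    and a b \<sigma> Qbar Vbar :: real
  assumes a: "0 \<le> a" and b: "0 \<le> b" and Qbar: "0 \<le> Qbar"
    and \<rho>: "prob_on_pos \<rho>" and \<theta>: "prob_on_pos \<theta>"
    and discharge: "discharge_process P \<theta> Qbar Vbar Q"
    and memory: "memory_measure_process P a b \<sigma> \<rho> Q B m"
begin

sublocale \<rho>: prob_space \<rho>
  using \<rho> by (simp add: prob_on_pos_def)

sublocale \<theta>: prob_space \<theta>
  using \<theta> by (simp add: prob_on_pos_def)

lemma sets_\<rho> [measurable_cong]: "sets \<rho> = sets pos_borel"
  using \<rho> by (simp add: prob_on_pos_def)

text \<open>
  The level towards which the measure reverts: the drift is $-R (m_t - X_t \rho)\,dt$ with $X_t$
  this process.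
\<close>

definition target :: "real \<Rightarrow> 'w \<Rightarrow> real" where
  "target s w = a + b * Q s w"

text \<open>
  The common mean of the reversion levels, which turns out to be the mean of the memory.
\<close>

definition target_mean :: real where
  "target_mean = a + b * Qbar"

lemma target_mean_nonneg: "0 \<le> target_mean"
  using a b Qbar by (simp add: target_mean_def)

lemma Q_jointly_measurable [measurable]:
  "case_prod Q \<in> borel_measurable (borel \<Otimes>\<^sub>M P)"
  using discharge by (simp add: discharge_process_def measurable_process_def)

lemma target_jointly_measurable [measurable]:
  "case_prod target \<in> borel_measurable (borel \<Otimes>\<^sub>M P)"
  unfolding target_def by measurable

lemma Q_measurable [measurable]: "Q s \<in> borel_measurable P"
  using measurable_Pair2[OF Q_jointly_measurable, of s] by simp

lemma target_measurable [measurable]: "target s \<in> borel_measurable P"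
  unfolding target_def by measurable

lemma Q_integrable: "integrable P (Q s)" "integrable P (\<lambda>w. (Q s w)\<^sup>2)"
  and Q_mean: "expectation (Q s) = Qbar"
  and Q_covariance: "expectation (\<lambda>w. (Q s w - Qbar) * (Q s' w - Qbar)) = Vbar * exp_mixture \<theta> \<bar>s - s'\<bar>"
  using discharge by (auto simp: discharge_process_def)

lemma target_square_integrable: "integrable P (\<lambda>w. (target s w)\<^sup>2)"
  unfolding target_def power2_sum power_mult_distrib
  using Q_integrable[of s] by (simp add: mult.assoc)

lemma expectation_target: "expectation (target s) = target_mean"
  unfolding target_def target_mean_def using Q_integrable[of s] by (simp add: Q_mean prob_space)

lemma target_second_moment:
  "expectation (\<lambda>w. target s w * target s' w) = target_mean\<^sup>2 + b\<^sup>2 * Vbar * exp_mixture \<theta> \<bar>s - s'\<bar>"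
proof -
  let ?Y = "\<lambda>s w. Q s w - Qbar"
  have Y: "integrable P (?Y s)" "expectation (?Y s) = 0" for s
    using Q_integrable[of s] by (simp_all add: Q_mean prob_space)
  have "integrable P (\<lambda>w. (?Y s w)\<^sup>2)" for s
    unfolding power2_diff using Q_integrable[of s] by simp
  then have YY: "integrable P (\<lambda>w. ?Y s w * ?Y s' w)"
    by (intro integrable_mult_of_square_integrable) simp_all
  have "(\<lambda>w. target s w * target s' w) =
      (\<lambda>w. target_mean\<^sup>2 + target_mean * b * ?Y s w + target_mean * b * ?Y s' w + b\<^sup>2 * (?Y s w * ?Y s' w))"
    by (rule ext) (simp add: target_def target_mean_def power2_eq_square algebra_simps)
  moreover have "expectation (\<lambda>w. target_mean\<^sup>2 + target_mean * b * ?Y s w + target_mean * b * ?Y s' w +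
      b\<^sup>2 * (?Y s w * ?Y s' w))
      = target_mean\<^sup>2 + target_mean * b * expectation (?Y s) + target_mean * b * expectation (?Y s')
        + b\<^sup>2 * expectation (\<lambda>w. ?Y s w * ?Y s' w)"
    using Y(1) YY by (simp add: prob_space del: Bochner_Integration.integral_diff)
  ultimately show ?thesis
    by (simp add: Y(2) Q_covariance)
qed

text \<open>
  The second moment of the reversion level, which does not depend on time because the
  autocorrelation at lag 0 is the total mass of \<open>\<theta>\<close>.
\<close>

definition L2bound :: real where
  "L2bound = target_mean\<^sup>2 + b\<^sup>2 * Vbar"

lemma target_square_mean: "expectation (\<lambda>w. (target s w)\<^sup>2) = L2bound"
  using target_second_moment[of s s]
  by (simp add: L2bound_def exp_mixture_def power2_eq_square \<theta>.prob_space)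

definition past_average :: "real \<Rightarrow> real \<Rightarrow> 'w \<Rightarrow> real" where
  "past_average t R w = (\<integral>s. target s w \<partial>past_law t R)"

lemma past_family:
  assumes "0 < R"
  shows "bounded_L2_family (past_law t R) P target L2bound"
proof -
  interpret R: prob_space "past_law t R"
    using assms by (rule prob_space_past_law)
  interpret pair_prob_space "past_law t R" P ..
  show ?thesis
    by unfold_locales (simp_all add: target_square_integrable target_square_mean)
qed

lemma past_family_average:
  assumes "0 < R"
  shows "bounded_L2_family.average (past_law t R) target = past_average t R"
  using bounded_L2_family.average_def[OF past_family[OF assms, of t]] by (simp add: past_average_def fun_eq_iff)

lemma past_average_eq:
  assumes R: "0 < R" and w: "w \<in> space P"
  shows "past_average t R w = (\<integral>s. indicator {..t} s * (exp (- (R * (t - s))) * (R * target s w)) \<partial>lborel)"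
proof -
  have [measurable]: "(\<lambda>s. target s w) \<in> borel_measurable borel"
    using measurable_Pair1[OF target_jointly_measurable w] by simp
  have "past_average t R w = (\<integral>s. exponential_density R (t - s) *\<^sub>R target s w \<partial>lborel)"
    unfolding past_average_def past_law_def using R
    by (intro integral_density) (simp_all add: exponential_density_nonneg)
  then show ?thesis
    by (simp add: exponential_density_diff mult_ac)
qed

lemma past_average_square_integrable: "0 < R \<Longrightarrow> integrable P (\<lambda>w. (past_average t R w)\<^sup>2)"
  and past_average_square_bound: "0 < R \<Longrightarrow> expectation (\<lambda>w. (past_average t R w)\<^sup>2) \<le> L2bound"
  and past_average_measurable: "0 < R \<Longrightarrow> past_average t R \<in> borel_measurable P"
  and past_average_mult: "0 < R \<Longrightarrow> Y \<in> borel_measurable P \<Longrightarrow>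
      integrable P (\<lambda>w. (Y w)\<^sup>2) \<Longrightarrow>
    expectation (\<lambda>w. past_average t R w * Y w) = (\<integral>s. expectation (\<lambda>w. target s w * Y w) \<partial>past_law t R)"
  using bounded_L2_family.average_square_integrable[OF past_family, of R t]
    bounded_L2_family.average_square_bound[OF past_family, of R t]
    bounded_L2_family.average_measurable[OF past_family, of R t]
    bounded_L2_family.expectation_average_mult[OF past_family, of R Y t]
  by (simp_all add: past_family_average)

lemma past_average_mean: "0 < R \<Longrightarrow> expectation (past_average t R) = target_mean"
  using past_average_mult[of R "\<lambda>_. 1" t] prob_space.prob_space[OF prob_space_past_law, of R t]
  by (simp add: expectation_target)

text \<open>
  The inner product is carried under both averages, one factor at a time; what remains is the
  covariance of the reversion level averaged over two independent exponential pasts.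
\<close>

lemma past_average_second_moment:
  assumes R: "0 < R" and p: "0 < p"
  shows "expectation (\<lambda>w. past_average t R w * past_average t p w) = target_mean\<^sup>2 + b\<^sup>2 * Vbar *
    (\<integral>r. p * R / (p + R) * (1 / (p + r) + 1 / (R + r)) \<partial>\<theta>)"
proof -
  interpret R: prob_space "past_law t R"
    using R by (rule prob_space_past_law)
  interpret p: prob_space "past_law t p"
    using p by (rule prob_space_past_law)
  have exp_le: "exp (- (r * h)) \<le> 1" if "0 \<le> h" "r \<in> space \<theta>" for r h
    using that space_prob_on_pos[OF \<theta>] by simp
  have mix_bound: "\<bar>exp_mixture \<theta> \<bar>h\<bar>\<bar> \<le> 1" for h
  proof -
    have "exp_mixture \<theta> \<bar>h\<bar> \<le> 1"
    proof (cases "integrable \<theta> (\<lambda>r. exp (- (r * \<bar>h\<bar>)))")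
      case True
      then show ?thesis
        unfolding exp_mixture_def by (intro \<theta>.integral_le_const AE_I2 exp_le) auto
    qed (simp add: exp_mixture_def not_integrable_integral_eq)
    moreover have "0 \<le> exp_mixture \<theta> \<bar>h\<bar>"
      by (simp add: exp_mixture_def)
    ultimately show ?thesis by simp
  qed
  have [measurable_cong]: "sets \<theta> = sets pos_borel"
    using \<theta> by (simp add: prob_on_pos_def)
  have [measurable]: "(\<lambda>h. exp_mixture \<theta> h) \<in> borel_measurable borel"
    unfolding exp_mixture_def by measurable
  have mix: "integrable (past_law t p) (\<lambda>s'. exp_mixture \<theta> \<bar>s - s'\<bar>)" for s
    by (rule p.integrable_const_bound[where B=1]) (simp_all add: mix_bound)
  have mix_avg_bound: "\<bar>\<integral>s'. exp_mixture \<theta> \<bar>s - s'\<bar> \<partial>past_law t p\<bar> \<le> 1" for s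
  proof -
    have "(\<integral>s'. exp_mixture \<theta> \<bar>s - s'\<bar> \<partial>past_law t p) \<le> 1"
      using mix mix_bound by (intro p.integral_le_const AE_I2) (auto simp: abs_le_iff)
    moreover have "0 \<le> (\<integral>s'. exp_mixture \<theta> \<bar>s - s'\<bar> \<partial>past_law t p)"
      by (simp add: exp_mixture_def)
    ultimately show ?thesis by simp
  qed
  have "expectation (\<lambda>w. past_average t R w * past_average t p w)
      = (\<integral>s. expectation (\<lambda>w. past_average t p w * target s w) \<partial>past_law t R)"
    using R p by (simp add: past_average_mult past_average_measurable past_average_square_integrable
        mult.commute[of "past_average t p _"])
  also have "\<dots> = (\<integral>s. target_mean\<^sup>2 + b\<^sup>2 * Vbar * (\<integral>s'. exp_mixture \<theta> \<bar>s - s'\<bar> \<partial>past_law t p) \<partial>past_law t R)"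
    using p mix
    by (simp add: past_average_mult target_square_integrable target_second_moment
        p.prob_space[simplified] abs_minus_commute[of _ s for s])
  also have "\<dots> = target_mean\<^sup>2 + b\<^sup>2 * Vbar *
      (\<integral>s. (\<integral>s'. exp_mixture \<theta> \<bar>s - s'\<bar> \<partial>past_law t p) \<partial>past_law t R)"
  proof -
    have "integrable (past_law t R) (\<lambda>s. \<integral>s'. exp_mixture \<theta> \<bar>s - s'\<bar> \<partial>past_law t p)"
      by (rule R.integrable_const_bound[where B=1]) (simp_all add: mix_avg_bound)
    then show ?thesis by (simp add: R.prob_space[simplified])
  qed
  finally show ?thesis
    by (simp only: integral_past_law_pair_exp_mixture[OF \<theta> p R])
qed

text \<open>
  The part of the mass of \<open>A\<close> that is due to the drift.  Indicators of sets of rates are kept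
  as factors, so that the averages over all rates and over \<open>A\<close> are instances of one family.
\<close>

definition drift_mass :: "real \<Rightarrow> real set \<Rightarrow> 'w \<Rightarrow> real" where
  "drift_mass t A w = (\<integral>R. indicator A R * past_average t R w \<partial>\<rho>)"

lemma rate_pos: "R \<in> space \<rho> \<Longrightarrow> 0 < R"
  using space_prob_on_pos[OF \<rho>] by auto

lemma rate_family:
  assumes A [measurable]: "A \<in> sets pos_borel"
  shows "bounded_L2_family \<rho> P (\<lambda>R w. indicator A R * past_average t R w) L2bound"
proof -
  interpret pair_prob_space \<rho> P ..
  show ?thesis
  proof unfold_locales
    \<comment> \<open>The measure \<open>past_law t R\<close> varies with \<open>R\<close>; joint measurability is read off from the
      integral with respect to the fixed measure \<open>lborel\<close>.\<close>
    have "(\<lambda>(R, w). indicator A R * (\<integral>s. indicator {..t} s * (exp (- (R * (t - s))) * (R * target s w))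
        \<partial>lborel))
        \<in> borel_measurable (\<rho> \<Otimes>\<^sub>M P)"
      by measurable
    then show "(\<lambda>(R, w). indicator A R * past_average t R w) \<in> borel_measurable (\<rho> \<Otimes>\<^sub>M P)"
      by (rule measurable_cong[THEN iffD1, rotated])
        (auto simp: space_pair_measure past_average_eq rate_pos)
    fix R assume "R \<in> space \<rho>"
    then have R: "0 < R" by (rule rate_pos)
    show "integrable P (\<lambda>w. (indicator A R * past_average t R w)\<^sup>2)"
      using past_average_square_integrable[OF R] by (simp add: power_mult_distrib)
    show "(\<integral>w. (indicator A R * past_average t R w)\<^sup>2 \<partial>P) \<le> L2bound"
      using past_average_square_bound[OF R, of t] target_square_mean[of 0, symmetric]
      by (simp add: indicator_def)
  qed
qed

lemma rate_family_average:
  assumes "A \<in> sets pos_borel"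
  shows "bounded_L2_family.average \<rho> (\<lambda>R w. indicator A R * past_average t R w) = drift_mass t A"
  using bounded_L2_family.average_def[OF rate_family[OF assms, of t]] by (simp add: drift_mass_def fun_eq_iff)

lemma drift_mass_measurable: "A \<in> sets pos_borel \<Longrightarrow> drift_mass t A \<in> borel_measurable P"
  and drift_mass_square_integrable: "A \<in> sets pos_borel \<Longrightarrow>
      integrable P (\<lambda>w. (drift_mass t A w)\<^sup>2)"
  and drift_mass_integrable: "A \<in> sets pos_borel \<Longrightarrow> integrable P (drift_mass t A)"
  and drift_mass_mult: "A \<in> sets pos_borel \<Longrightarrow> Y \<in> borel_measurable P \<Longrightarrow>
      integrable P (\<lambda>w. (Y w)\<^sup>2) \<Longrightarrow>
    expectation (\<lambda>w. drift_mass t A w * Y w) =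
      (\<integral>R. indicator A R * expectation (\<lambda>w. past_average t R w * Y w) \<partial>\<rho>)"
  using bounded_L2_family.average_square_integrable[OF rate_family, of A t]
    bounded_L2_family.average_integrable[OF rate_family, of A t]
    bounded_L2_family.average_measurable[OF rate_family, of A t]
    bounded_L2_family.expectation_average_mult[OF rate_family, of A Y t]
  by (simp_all add: rate_family_average mult.assoc)

lemma drift_mass_mean:
  assumes A: "A \<in> sets pos_borel"
  shows "expectation (drift_mass t A) = target_mean * measure \<rho> A"
proof -
  have "expectation (drift_mass t A) = (\<integral>R. indicator A R * expectation (past_average t R) \<partial>\<rho>)"
    using drift_mass_mult[OF A, of "\<lambda>_. 1" t] by simp
  also have "\<dots> = (\<integral>R. target_mean * indicator A R \<partial>\<rho>)"
    by (intro Bochner_Integration.integral_cong) (auto simp: past_average_mean rate_pos)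
  also have "\<dots> = target_mean * measure \<rho> A"
    using A sets.sets_into_space[of A \<rho>] by (simp add: sets_\<rho> Int_absorb1)
  finally show ?thesis .
qed

lemma rates_sets [measurable]: "{0<..} \<in> sets pos_borel"
  by (simp add: pos_borel_def sets_restrict_space_iff)

text \<open>
  The kernel is bounded by 1, since $\frac{PR}{P+R}\left(\frac1P + \frac1R\right) = 1$; this
  gives the integrability needed to separate the constant term from the triple integral.
\<close>

lemma drift_mass_total_square_mean:
  "expectation (\<lambda>w. (drift_mass t {0<..} w)\<^sup>2) = target_mean\<^sup>2 + b\<^sup>2 * Vbar *
    (\<integral>R. (\<integral>p. (\<integral>r. p * R / (p + R) * (1 / (p + r) + 1 / (R + r)) \<partial>\<theta>) \<partial>\<rho>) \<partial>\<rho>)"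
proof -
  define k where "k R p = (\<integral>r. p * R / (p + R) * (1 / (p + r) + 1 / (R + r)) \<partial>\<theta>)" for R p :: real
  have [measurable_cong]: "sets \<theta> = sets pos_borel"
    using \<theta> by (simp add: prob_on_pos_def)
  have k_measurable [measurable]: "case_prod k \<in> borel_measurable (\<rho> \<Otimes>\<^sub>M \<rho>)"
    unfolding k_def by measurable
  have k_bound: "\<bar>k R p\<bar> \<le> 1" if "R \<in> space \<rho>" "p \<in> space \<rho>" for R p
  proof -
    have Rp: "0 < R" "0 < p" using that by (auto intro: rate_pos)
    have r: "0 \<le> p * R / (p + R) * (1 / (p + r) + 1 / (R + r))
        \<and> p * R / (p + R) * (1 / (p + r) + 1 / (R + r)) \<le> 1" if "r \<in> space \<theta>" for r
    proof -
      have "0 < r"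
        using that space_prob_on_pos[OF \<theta>] by auto
      then have "p * R / (p + R) * (1 / (p + r) + 1 / (R + r)) \<le> p * R / (p + R) * (1 / p + 1 / R)"
        using Rp by (intro mult_left_mono add_mono divide_left_mono) auto
      also have "1 / p + 1 / R = (p + R) / (p * R)"
        using Rp by (simp add: field_simps)
      also have "p * R / (p + R) * ((p + R) / (p * R)) = 1"
        using Rp by simp
      finally show ?thesis
        using Rp \<open>0 < r\<close> by simp
    qed
    have "k R p \<le> 1"
    proof (cases "integrable \<theta> (\<lambda>r. p * R / (p + R) * (1 / (p + r) + 1 / (R + r)))")
      case True
      with r show ?thesis
        unfolding k_def by (intro \<theta>.integral_le_const AE_I2) auto
    next
      case False
      then show ?thesis
        unfolding k_def by (subst not_integrable_integral_eq) auto
    qed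
    moreover have "0 \<le> k R p"
      unfolding k_def using r by (intro Bochner_Integration.integral_nonneg) auto
    ultimately show ?thesis by simp
  qed
  have k_int: "integrable \<rho> (k R)" if "R \<in> space \<rho>" for R
    using that k_bound measurable_Pair2[OF k_measurable that]
    by (intro \<rho>.integrable_const_bound[where B=1] AE_I2) auto
  have k_avg_bound: "\<bar>\<integral>p. k R p \<partial>\<rho>\<bar> \<le> 1" if "R \<in> space \<rho>" for R
  proof -
    have "\<bar>\<integral>p. k R p \<partial>\<rho>\<bar> \<le> (\<integral>p. \<bar>k R p\<bar> \<partial>\<rho>)"
      by (rule integral_abs_bound)
    also have "\<dots> \<le> 1"
      using that k_int k_bound by (intro \<rho>.integral_le_const AE_I2) auto
    finally show ?thesis .
  qed
  have inner: "expectation (\<lambda>w. past_average t R w * drift_mass t {0<..} w)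
      = target_mean\<^sup>2 + b\<^sup>2 * Vbar * (\<integral>p. k R p \<partial>\<rho>)"
    if R: "R \<in> space \<rho>" for R
  proof -
    have "expectation (\<lambda>w. past_average t R w * drift_mass t {0<..} w)
        = (\<integral>p. indicator {0<..} p * expectation (\<lambda>w. past_average t p w * past_average t R w) \<partial>\<rho>)"
      using drift_mass_mult[OF rates_sets, of "past_average t R" t] R
      by (simp add: past_average_measurable past_average_square_integrable rate_pos mult.commute)
    also have "\<dots> = (\<integral>p. target_mean\<^sup>2 + b\<^sup>2 * Vbar * k R p \<partial>\<rho>)"
    proof (intro Bochner_Integration.integral_cong refl)
      fix p assume "p \<in> space \<rho>"
      then show "indicator {0<..} p * expectation (\<lambda>w. past_average t p w * past_average t R w)
          = target_mean\<^sup>2 + b\<^sup>2 * Vbar * k R p"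
        using past_average_second_moment[OF rate_pos[OF R] rate_pos, of p t]
        by (simp add: rate_pos k_def mult.commute[of "past_average t p _"])
    qed
    also have "\<dots> = target_mean\<^sup>2 + b\<^sup>2 * Vbar * (\<integral>p. k R p \<partial>\<rho>)"
      using k_int[OF R] by (simp add: \<rho>.prob_space)
    finally show ?thesis .
  qed
  have "expectation (\<lambda>w. (drift_mass t {0<..} w)\<^sup>2)
      = (\<integral>R. indicator {0<..} R * expectation (\<lambda>w. past_average t R w * drift_mass t {0<..} w) \<partial>\<rho>)"
    unfolding power2_eq_square
    using rates_sets by (intro drift_mass_mult drift_mass_measurable drift_mass_square_integrable)
  also have "\<dots> = (\<integral>R. target_mean\<^sup>2 + b\<^sup>2 * Vbar * (\<integral>p. k R p \<partial>\<rho>) \<partial>\<rho>)"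
    by (intro Bochner_Integration.integral_cong refl) (simp add: inner rate_pos)
  also have "\<dots> = target_mean\<^sup>2 + b\<^sup>2 * Vbar * (\<integral>R. (\<integral>p. k R p \<partial>\<rho>) \<partial>\<rho>)"
  proof -
    have "integrable \<rho> (\<lambda>R. \<integral>p. k R p \<partial>\<rho>)"
      by (rule \<rho>.integrable_const_bound[where B=1])
        (auto intro!: AE_I2 k_avg_bound)
    then show ?thesis by (simp add: \<rho>.prob_space)
  qed
  finally show ?thesis
    unfolding k_def .
qed

section \<open>The noise\<close>

definition noise_mass :: "real \<Rightarrow> real set \<Rightarrow> 'w \<Rightarrow> real" where
  "noise_mass t A = B (noise_kernel \<sigma> t A)"

lemma noise: "memory_noise P Q m B"
  and m_jointly_measurable: "(\<lambda>(s, w). m s w) \<in> measurable (borel \<Otimes>\<^sub>M P) (measure_algebra pos_borel)"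
  and m_measurable: "m s \<in> measurable P (measure_algebra pos_borel)"
  using memory
  by (auto simp: memory_measure_process_def measurable_process_def stationary_process_def)

lemma admissible_noise_kernel:
  "A \<in> sets pos_borel \<Longrightarrow> admissible_integrand P m (noise_kernel \<sigma> t A)"
  using memory by (auto simp: memory_measure_process_def)

lemma noise_mass_measurable: "A \<in> sets pos_borel \<Longrightarrow> noise_mass t A \<in> borel_measurable P"
  and noise_mass_square_integrable: "A \<in> sets pos_borel \<Longrightarrow>
      integrable P (\<lambda>w. (noise_mass t A w)\<^sup>2)"
  and noise_mass_mean: "A \<in> sets pos_borel \<Longrightarrow> expectation (noise_mass t A) = 0"
  using noise admissible_noise_kernel[of A t] unfolding memory_noise_def noise_mass_def by blast+

lemma noise_mass_integrable: "A \<in> sets pos_borel \<Longrightarrow> integrable P (noise_mass t A)"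
  by (rule square_integrable_imp_integrable[OF noise_mass_measurable noise_mass_square_integrable])

text \<open>
  A single value \<open>Q s\<close> is trivially measurable with respect to the sigma-algebra of the
  discharge, so the postulate on the noise applies to it.
\<close>

lemma target_noise_uncorrelated:
  assumes A: "A \<in> sets pos_borel"
  shows "expectation (\<lambda>w. target s w * noise_mass t A w) = 0"
proof -
  have "(\<lambda>w u. Q u w) \<in> measurable (process_sigma P Q) (\<Pi>\<^sub>M u\<in>UNIV. borel)"
    unfolding process_sigma_def by (rule measurable_vimage_algebra1) (simp add: space_PiM)
  then have "(\<lambda>w. Q s w) \<in> borel_measurable (process_sigma P Q)"
    by (rule measurable_compose) (simp add: measurable_component_singleton)
  then have "expectation (\<lambda>w. Q s w * noise_mass t A w) = expectation (Q s) * expectation (noise_mass t A)"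
    using noise admissible_noise_kernel[OF A, of t] Q_integrable(2)[of s]
    unfolding memory_noise_def noise_mass_def by blast
  then have Q0: "expectation (\<lambda>w. Q s w * noise_mass t A w) = 0"
    by (simp add: noise_mass_mean[OF A])
  have int: "integrable P (\<lambda>w. Q s w * noise_mass t A w)"
    using A by (intro integrable_mult_of_square_integrable Q_measurable noise_mass_measurable
        Q_integrable noise_mass_square_integrable)
  have "expectation (\<lambda>w. target s w * noise_mass t A w)
      = expectation (\<lambda>w. a * noise_mass t A w + b * (Q s w * noise_mass t A w))"
    by (simp add: target_def distrib_right mult.assoc)
  also have "\<dots> = a * expectation (noise_mass t A) + b * expectation (\<lambda>w. Q s w * noise_mass t A w)"
    using int noise_mass_integrable[OF A] by simp
  also have "\<dots> = 0"
    by (simp add: Q0 noise_mass_mean[OF A])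
  finally show ?thesis .
qed

lemma drift_noise_uncorrelated:
  assumes A: "A \<in> sets pos_borel" and A': "A' \<in> sets pos_borel"
  shows "expectation (\<lambda>w. drift_mass t A w * noise_mass t A' w) = 0"
proof -
  have "expectation (\<lambda>w. drift_mass t A w * noise_mass t A' w)
      = (\<integral>R. indicator A R * expectation (\<lambda>w. past_average t R w * noise_mass t A' w) \<partial>\<rho>)"
    by (rule drift_mass_mult[OF A noise_mass_measurable[OF A'] noise_mass_square_integrable[OF A']])
  also have "\<dots> = (\<integral>R. 0 \<partial>\<rho>)"
  proof (intro Bochner_Integration.integral_cong refl)
    fix R assume "R \<in> space \<rho>"
    then have "expectation (\<lambda>w. past_average t R w * noise_mass t A' w)
        = (\<integral>s. expectation (\<lambda>w. target s w * noise_mass t A' w) \<partial>past_law t R)"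
      by (intro past_average_mult rate_pos noise_mass_measurable noise_mass_square_integrable A')
    then show "indicator A R * expectation (\<lambda>w. past_average t R w * noise_mass t A' w) = 0"
      by (simp add: target_noise_uncorrelated[OF A'])
  qed
  finally show ?thesis by simp
qed

lemma mass_decomposition:
  assumes A: "A \<in> sets pos_borel"
  shows "AE w in P. emeasure (m t w) A < \<infinity> \<and> measure (m t w) A = drift_mass t A w + noise_mass t A w"
proof -
  have memory_eq: "AE w in P. emeasure (m t w) A < \<infinity> \<and> measure (m t w) A =
        (LINT R:A|\<rho>. LINT s:{..t}|lborel. exp (- (R * (t - s))) * (R * (a + b * Q s w)))
        + B (noise_kernel \<sigma> t A) w"
    using memory A unfolding memory_measure_process_def by blast
  have "(LINT R:A|\<rho>. LINT s:{..t}|lborel. exp (- (R * (t - s))) * (R * (a + b * Q s w)))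
      = drift_mass t A w" if "w \<in> space P" for w
    unfolding drift_mass_def set_lebesgue_integral_def
    using that by (intro Bochner_Integration.integral_cong) (auto simp: past_average_eq rate_pos target_def)
  note eq = this
  show ?thesis
    using memory_eq AE_space by eventually_elim (simp add: noise_mass_def eq)
qed

text \<open>
  Since the noise has mean zero, only the drift contributes to the mean mass of a set of rates.
\<close>

lemma mean_measure:
  assumes A: "A \<in> sets pos_borel"
  shows "(\<integral>\<^sup>+w. emeasure (m t w) A \<partial>P) = ennreal target_mean * emeasure \<rho> A"
proof -
  have "AE w in P. emeasure (m t w) A = ennreal (drift_mass t A w + noise_mass t A w)
      \<and> 0 \<le> drift_mass t A w + noise_mass t A w"
    using mass_decomposition[OF A, of t]
  proof eventually_elim
    case (elim w)
    then have "emeasure (m t w) A = ennreal (measure (m t w) A)"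
      by (intro emeasure_eq_ennreal_measure) auto
    with elim show ?case
      using measure_nonneg[of "m t w" A] by simp
  qed
  then have *: "AE w in P. emeasure (m t w) A = ennreal (drift_mass t A w + noise_mass t A w)"
      "AE w in P. 0 \<le> drift_mass t A w + noise_mass t A w"
    by auto
  have "(\<integral>\<^sup>+w. emeasure (m t w) A \<partial>P) = (\<integral>\<^sup>+w. ennreal (drift_mass t A w + noise_mass t A w) \<partial>P)"
    by (rule nn_integral_cong_AE) (rule *)
  also have "\<dots> = ennreal (expectation (\<lambda>w. drift_mass t A w + noise_mass t A w))"
    using A by (intro nn_integral_eq_integral * Bochner_Integration.integrable_add drift_mass_integrable
        noise_mass_integrable)
  also have "expectation (\<lambda>w. drift_mass t A w + noise_mass t A w) = target_mean * measure \<rho> A"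
    using A by (simp add: drift_mass_integrable noise_mass_integrable drift_mass_mean noise_mass_mean)
  finally show ?thesis
    by (simp add: ennreal_mult target_mean_nonneg \<rho>.emeasure_eq_measure)
qed

lemma noise_kernel_square:
  assumes "0 < R"
  shows "ennreal ((noise_kernel \<sigma> t {0<..} (R, s))\<^sup>2)
    = indicator {..t} s * (ennreal (\<sigma>\<^sup>2 * R) * ennreal (exp (- (2 * R * (t - s)))))"
proof -
  have "(exp (- (R * (t - s))) * (\<sigma> * sqrt R))\<^sup>2 = \<sigma>\<^sup>2 * R * exp (- (2 * R * (t - s)))"
    using assms by (simp add: power_mult_distrib exp_double[symmetric] mult_ac)
  then show ?thesis
    using assms by (simp add: noise_kernel_def indicator_def flip: ennreal_mult')
qed

text \<open>
  By the isometry this is the mean of the integral of the squared kernel against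
  $m_s(dR)\,ds$.  After exchanging the integrals, $m_s$ is replaced by its mean measure, and
  $\int_{s \le t} \sigma^2 R e^{-2R(t-s)}\, ds = \frac12 \sigma^2$ for every rate $R$.
\<close>

lemma noise_mass_total_square_mean: "expectation (\<lambda>w. (noise_mass t {0<..} w)\<^sup>2) = 1 / 2 * \<sigma>\<^sup>2 * target_mean"
proof -
  let ?f = "noise_kernel \<sigma> t {0<..}"
  define H where "H s w = (\<integral>\<^sup>+R. ennreal ((?f (R, s))\<^sup>2) \<partial>m s w)" for s w
  have sets_m: "sets (m s w) = sets pos_borel" if "w \<in> space P" for s w
    using measurable_space[OF m_measurable that, of s] by (simp add: space_measure_algebra)
  have space_m: "R \<in> space (m s w) \<longleftrightarrow> 0 < R" if "w \<in> space P" for R s w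
    using sets_eq_imp_space_eq[OF sets_m[OF that]] by (simp add: pos_borel_def space_restrict_space)
  have id [measurable]: "(\<lambda>R. R) \<in> borel_measurable pos_borel"
    by (intro borel_measurable_pos_borel) simp
  have f [measurable]: "?f \<in> borel_measurable (pos_borel \<Otimes>\<^sub>M borel)"
    using admissible_noise_kernel[OF rates_sets] by (simp add: admissible_integrand_def)
  have f_section [measurable]: "(\<lambda>R. ?f (R, s)) \<in> borel_measurable pos_borel" for s
    by measurable
  have H_eq: "H s w = indicator {..t} s *
      (\<integral>\<^sup>+R. ennreal (\<sigma>\<^sup>2 * R) * ennreal (exp (- (2 * R * (t - s)))) \<partial>m s w)" if "w \<in> space P" for s w
  proof -
    have "H s w = (\<integral>\<^sup>+R. indicator {..t} s * (ennreal (\<sigma>\<^sup>2 * R) * ennreal (exp (- (2 * R * (t - s))))) \<partial>m s w)"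
      unfolding H_def using that by (intro nn_integral_cong noise_kernel_square) (simp add: space_m)
    then show ?thesis by (simp add: indicator_def)
  qed
  have H_measurable [measurable]: "case_prod H \<in> borel_measurable (borel \<Otimes>\<^sub>M P)"
  proof -
    have "(\<lambda>z. indicator {..t} (fst z) * (\<integral>\<^sup>+R. ennreal (\<sigma>\<^sup>2 * R) * ennreal (exp (- (2 * R * (t - fst z))))
        \<partial>(case z of (s, w) \<Rightarrow> m s w))) \<in> borel_measurable (borel \<Otimes>\<^sub>M P)"
      by (rule measurable_nn_integral_exp_family[OF m_jointly_measurable]) measurable
    then show ?thesis
      by (rule measurable_cong[THEN iffD1, rotated]) (auto simp: space_pair_measure H_eq)
  qed
  have H_section [measurable]: "(\<lambda>s. H s w) \<in> borel_measurable borel" if "w \<in> space P" for w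
    using measurable_Pair1[OF H_measurable that] by simp
  interpret lP: pair_sigma_finite lborel P ..
  have H_swap: "(\<integral>\<^sup>+w. (\<integral>\<^sup>+s. H s w \<partial>lborel) \<partial>P) = (\<integral>\<^sup>+s. (\<integral>\<^sup>+w. H s w \<partial>P) \<partial>lborel)"
    by (rule lP.Fubini') measurable
  have H_mean: "(\<integral>\<^sup>+w. H s w \<partial>P) = ennreal target_mean * (\<integral>\<^sup>+R. ennreal ((?f (R, s))\<^sup>2) \<partial>\<rho>)" for s
    unfolding H_def using f_section[of s]
    by (intro nn_integral_mean_measure[OF m_measurable sets_\<rho> mean_measure]) simp_all
  interpret \<rho>l: pair_sigma_finite \<rho> lborel ..
  have "(\<integral>\<^sup>+s. (\<integral>\<^sup>+R. ennreal ((?f (R, s))\<^sup>2) \<partial>\<rho>) \<partial>lborel)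
      = (\<integral>\<^sup>+R. (\<integral>\<^sup>+s. ennreal ((?f (R, s))\<^sup>2) \<partial>lborel) \<partial>\<rho>)"
    by (rule \<rho>l.Fubini') measurable
  also have "\<dots> = (\<integral>\<^sup>+R. ennreal (\<sigma>\<^sup>2 / 2) \<partial>\<rho>)"
  proof (intro nn_integral_cong)
    fix R assume "R \<in> space \<rho>"
    then have R: "0 < R" by (rule rate_pos)
    have "(\<integral>\<^sup>+s. ennreal ((?f (R, s))\<^sup>2) \<partial>lborel)
        = (\<integral>\<^sup>+s. ennreal (\<sigma>\<^sup>2 * R) * (ennreal (exp (- (2 * R * (t - s)))) * indicator {..t} s) \<partial>lborel)"
      using R by (intro nn_integral_cong) (simp add: noise_kernel_square mult_ac)
    also have "\<dots> = ennreal (\<sigma>\<^sup>2 * R) * ennreal (1 / (2 * R))"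
      using R by (subst nn_integral_cmult) (simp_all add: nn_integral_exp_below)
    finally show "(\<integral>\<^sup>+s. ennreal ((?f (R, s))\<^sup>2) \<partial>lborel) = ennreal (\<sigma>\<^sup>2 / 2)"
      using R by (simp flip: ennreal_mult')
  qed
  also have "\<dots> = ennreal (\<sigma>\<^sup>2 / 2)"
    by (simp only: nn_integral_const \<rho>.emeasure_space_1 mult_1_right)
  finally have "(\<integral>\<^sup>+s. ennreal target_mean * (\<integral>\<^sup>+R. ennreal ((?f (R, s))\<^sup>2) \<partial>\<rho>) \<partial>lborel)
      = ennreal target_mean * ennreal (\<sigma>\<^sup>2 / 2)"
    by (subst nn_integral_cmult) simp_all
  then have total: "(\<integral>\<^sup>+w. (\<integral>\<^sup>+s. H s w \<partial>lborel) \<partial>P) = ennreal (1 / 2 * \<sigma>\<^sup>2 * target_mean)"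
    by (simp add: H_swap H_mean mult_ac target_mean_nonneg flip: ennreal_mult')
  have fin: "AE w in P. (\<integral>\<^sup>+s. H s w \<partial>lborel) \<noteq> \<infinity>"
    by (rule nn_integral_PInf_AE) (simp_all add: total)
  have inner: "(\<integral>R. ?f (R, s) * ?f (R, s) \<partial>m s w) = enn2real (H s w)" if "w \<in> space P" for s w
    unfolding H_def power2_eq_square[symmetric]
    using f_section[of s] sets_m[OF that, of s]
    by (intro integral_eq_nn_integral) (simp_all cong: measurable_cong_sets)
  \<comment> \<open>The isometry speaks of Bochner integrals, Tonelli's theorem of extended ones.  They agree on
    almost every path, because the extended integral has finite mean.\<close>
  have pathwise: "AE w in P. (\<integral>\<^sup>+s. H s w \<partial>lborel) = ennreal (\<integral>s. enn2real (H s w) \<partial>lborel)"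
    using fin AE_space
  proof eventually_elim
    case (elim w)
    have [measurable]: "(\<lambda>s. H s w) \<in> borel_measurable borel"
      using elim by (intro H_section)
    have "(\<integral>s. enn2real (H s w) \<partial>lborel) = enn2real (\<integral>\<^sup>+s. ennreal (enn2real (H s w)) \<partial>lborel)"
      by (rule integral_eq_nn_integral) simp_all
    also have "(\<integral>\<^sup>+s. ennreal (enn2real (H s w)) \<partial>lborel) = (\<integral>\<^sup>+s. H s w \<partial>lborel)"
    proof (rule nn_integral_cong_AE)
      have "AE s in lborel. H s w \<noteq> \<infinity>"
        using elim by (intro nn_integral_PInf_AE) auto
      then show "AE s in lborel. ennreal (enn2real (H s w)) = H s w"
        by eventually_elim (simp add: less_top)
    qed
    finally show ?case
      using elim by (simp add: less_top)
  qed
  have "expectation (\<lambda>w. (noise_mass t {0<..} w)\<^sup>2)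
      = expectation (\<lambda>w. noise_mass t {0<..} w * noise_mass t {0<..} w)"
    by (simp add: power2_eq_square)
  also have "\<dots> = expectation (\<lambda>w. \<integral>s. (\<integral>R. ?f (R, s) * ?f (R, s) \<partial>m s w) \<partial>lborel)"
    using noise admissible_noise_kernel[OF rates_sets, of t] unfolding memory_noise_def noise_mass_def by blast
  also have "\<dots> = expectation (\<lambda>w. \<integral>s. enn2real (H s w) \<partial>lborel)"
    by (intro Bochner_Integration.integral_cong refl) (simp add: inner)
  also have "\<dots> = enn2real (\<integral>\<^sup>+w. (\<integral>\<^sup>+s. H s w \<partial>lborel) \<partial>P)"
    by (rule enn2real_nn_integral_eq_integral[symmetric, OF pathwise]) (simp_all add: total)
  finally show ?thesis
    using target_mean_nonneg by (simp add: total)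
qed

section \<open>Mean and variance of the memory\<close>

lemma memory_moments:
  shows "integrable P (memory_process m t)"
    and "integrable P (\<lambda>w. (memory_process m t w)\<^sup>2)"
    and "expectation (memory_process m t) = target_mean"
    and "variance (memory_process m t) = 1 / 2 * \<sigma>\<^sup>2 * expectation (memory_process m t) + b\<^sup>2 * Vbar *
      (\<integral>R. (\<integral>p. (\<integral>r. p * R / (p + R) * (1 / (p + r) + 1 / (R + r)) \<partial>\<theta>) \<partial>\<rho>) \<partial>\<rho>)"
proof -
  let ?M = "memory_process m t" and ?D = "drift_mass t {0<..}" and ?N = "noise_mass t {0<..}"
  note [measurable] = drift_mass_measurable[OF rates_sets, of t] noise_mass_measurable[OF rates_sets, of t]
  have [measurable]: "?M \<in> borel_measurable P"
    unfolding memory_process_def measure_def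
    using measurable_compose[OF m_measurable measurable_emeasure_measure_algebra[OF rates_sets], of t]
    by measurable
  have M: "AE w in P. ?M w = ?D w + ?N w"
    using mass_decomposition[OF rates_sets, of t] by (auto simp: memory_process_def)
  have DN: "integrable P (\<lambda>w. ?D w * ?N w)"
    by (intro integrable_mult_of_square_integrable drift_mass_measurable noise_mass_measurable
        drift_mass_square_integrable noise_mass_square_integrable rates_sets)
  note int = drift_mass_integrable[OF rates_sets, of t] noise_mass_integrable[OF rates_sets, of t]
  note int2 = drift_mass_square_integrable[OF rates_sets, of t] noise_mass_square_integrable[OF
      rates_sets, of t] DN
  have sum2: "(\<lambda>w. (?D w + ?N w)\<^sup>2) = (\<lambda>w. (?D w)\<^sup>2 + (?N w)\<^sup>2 + 2 * (?D w * ?N w))"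
    by (rule ext) (simp add: power2_sum)
  have M2: "AE w in P. (?M w)\<^sup>2 = (?D w + ?N w)\<^sup>2"
    using M by eventually_elim simp
  show M_int: "integrable P ?M"
    by (subst integrable_cong_AE[OF _ _ M]) (simp_all add: int)
  have "integrable P (\<lambda>w. (?D w + ?N w)\<^sup>2)"
    unfolding sum2 using int2 by simp
  then show M2_int: "integrable P (\<lambda>w. (?M w)\<^sup>2)"
    by (subst integrable_cong_AE[OF _ _ M2]) simp_all
  have "expectation ?M = expectation (\<lambda>w. ?D w + ?N w)"
    by (rule integral_cong_AE[OF _ _ M]) measurable
  also have "\<dots> = target_mean"
    using int \<rho>.prob_space space_prob_on_pos[OF \<rho>] by
        (simp add: drift_mass_mean[OF rates_sets] noise_mass_mean[OF rates_sets])
  finally show M_mean: "expectation ?M = target_mean" .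
  have "expectation (\<lambda>w. (?M w)\<^sup>2) = expectation (\<lambda>w. (?D w + ?N w)\<^sup>2)"
    by (rule integral_cong_AE[OF _ _ M2]) measurable
  also have "\<dots> = expectation (\<lambda>w. (?D w)\<^sup>2) + expectation (\<lambda>w. (?N w)\<^sup>2)"
    unfolding sum2 using int2 by (simp add: drift_noise_uncorrelated[OF rates_sets rates_sets])
  finally have second_moment: "expectation (\<lambda>w. (?M w)\<^sup>2)
      = expectation (\<lambda>w. (?D w)\<^sup>2) + expectation (\<lambda>w. (?N w)\<^sup>2)" .
  have variance: "variance ?M = expectation (\<lambda>w. (?M w)\<^sup>2) - (expectation ?M)\<^sup>2"
    by (rule variance_eq[OF M_int M2_int])
  show "variance ?M = 1 / 2 * \<sigma>\<^sup>2 * expectation ?M + b\<^sup>2 * Vbar *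
      (\<integral>R. (\<integral>p. (\<integral>r. p * R / (p + R) * (1 / (p + r) + 1 / (R + r)) \<partial>\<theta>) \<partial>\<rho>) \<partial>\<rho>)"
    unfolding variance
    unfolding second_moment M_mean drift_mass_total_square_mean noise_mass_total_square_mean by simp
qed

end

theorem proposition1:
  fixes P :: "'w measure"
    and F :: "real \<Rightarrow> 'w measure"
    and Q :: "real \<Rightarrow> 'w \<Rightarrow> real"
    and m :: "real \<Rightarrow> 'w \<Rightarrow> real measure"
    and B :: "(real \<times> real \<Rightarrow> real) \<Rightarrow> 'w \<Rightarrow> real"
    and \<rho> \<theta> :: "real measure"
    and a b \<sigma> Qbar Vbar t :: real
  assumes "filtered_complete_prob_space P F"
    and "0 \<le> a" and "0 \<le> b" and "0 \<le> \<sigma>"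
    and "prob_on_pos \<rho>" and "prob_on_pos \<theta>"
    and "0 < Qbar" and "0 < Vbar"
    and "discharge_process P \<theta> Qbar Vbar Q"
    and "memory_measure_process P a b \<sigma> \<rho> Q B m"
  shows "integrable P (memory_process m t)
    \<and> integrable P (\<lambda>w. (memory_process m t w)\<^sup>2)
    \<and> prob_space.expectation P (memory_process m t) = a + b * Qbar
    \<and> prob_space.variance P (memory_process m t) =
        1 / 2 * \<sigma>\<^sup>2 * prob_space.expectation P (memory_process m t)
        + b\<^sup>2 * Vbar *
          (\<integral>R. (\<integral>p. (\<integral>r. p * R / (p + R) * (1 / (p + r) + 1 / (R + r)) \<partial>\<theta>) \<partial>\<rho>) \<partial>\<rho>)"
proof -
  have "prob_space P"
    using assms(1) by (simp add: filtered_complete_prob_space_def)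
  then interpret discharge_driven_memory P Q m B \<rho> \<theta> a b \<sigma> Qbar Vbar
    using assms by (intro discharge_driven_memory.intro discharge_driven_memory_axioms.intro) auto
  show ?thesis
    by (intro conjI memory_moments(1,2,4) memory_moments(3)[unfolded target_mean_def])
qed

end
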